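(* Let $X$ be a Hilbert space, let $T\colon X\rightrightarrows X$ be a set-valued mapping, let $(\bar x,\bar v)\in\mathrm{gph}\,T$, and suppose that $\mathrm{gph}\,T$ is locally closed around $(\bar x,\bar v)$. Let $\kappa>0$. The following are equivalent: (i) $T$ is locally strongly maximally monotone around $(\bar x,\bar v)$ with modulus $\kappa$. (ii) $T$ is hypomonotone around $(\bar x,\bar v)$ and there exists $\eta>0$ such that $$\langle z,w\rangle\ge\kappa\|w\|^2\quad\text{for all } z\in\widehat D^*T(u,v)(w),\ (u,v)\in\mathrm{gph}\,T\cap\mathbb B_\eta(\bar x,\bar v),\ w\in X.$$ Moreover, the conditions in (ii) ensure that $T$ is strongly metrically regular around $(\bar x,\bar v)$ with modulus $\kappa^{-1}$.
   Context: $X$ is a real Hilbert space identified with its dual, with inner product $\langle\cdot,\cdot\rangle$ and norm $\|\cdot\|$. For $T\colon X\rightrightarrows X$, $\mathrm{gph}\,T=\{(x,v):v\in T(x)\}$. $\mathbb B_\eta(x)$ is the closed ball of radius $\eta$ centered at $x$ and $\mathbb B_\eta(x,v)=\mathbb B_\eta(x)\times\mathbb B_\eta(v)$. An operator $S\colon X\rightrightarrows X$ is monotone if $\langle v_1-v_2,u_1-u_2\rangle\ge0$ for all $(u_1,v_1),(u_2,v_2)\in\mathrm{gph}\,S$. $T$ is locally strongly maximally monotone around $(\bar x,\bar v)$ with modulus $\kappa>0$ if there is a neighborhood $U\times V$ of $(\bar x,\bar v)$ such that $\langle v_1-v_2,u_1-u_2\rangle\ge\kappa\|u_1-u_2\|^2$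 for all $(u_1,v_1),(u_2,v_2)\in\mathrm{gph}\,T\cap(U\times V)$, and $\mathrm{gph}\,T\cap(U\times V)=\mathrm{gph}\,S\cap(U\times V)$ for every monotone operator $S\colon X\rightrightarrows X$ with $\mathrm{gph}\,T\cap(U\times V)\subset\mathrm{gph}\,S$. $T$ is hypomonotone around $(\bar x,\bar v)$ if there are a neighborhood $U\times V$ of $(\bar x,\bar v)$ and $r>0$ such that $\langle v_1-v_2,u_1-u_2\rangle\ge-r\|u_1-u_2\|^2$ for all $(u_1,v_1),(u_2,v_2)\in\mathrm{gph}\,T\cap(U\times V)$. Regular normal cone to a set $\Omega$ at $\bar z\in\Omega$: $\widehat N_\Omega(\bar z)=\{\zeta:\limsup_{z\to\bar z,\,z\in\Omega}\langle\zeta,z-\bar z\rangle/\|z-\bar z\|\le0\}$. Regular coderivative of $T$ at $(u,v)\in\mathrm{gph}\,T$: $\widehat D^*T(u,v)(w)=\{z\in X:(z,-w)\in\widehat N_{\mathrm{gph}\,T}(u,v)\}$, $w\in X$. $T$ is strongly metrically regular around $(\bar x,\bar v)$ with modulus $\mu>0$ if $T^{-1}$ admits a single-valued localization around $(\bar v,\bar x)$ that is Lipschitz continuous with constant $\mu$; that is, there is a neighborhood $V\times U$ of $(\bar v,\bar x)$ such that $\mathrm{gph}\,T^{-1}\cap(V\times U)$ is the graph of a single-valued mapping $\vartheta\colon V\to U$ defined on all of $V$ and Lipschitz continuous on $V$ with constant $\mu$. *)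

theory Defs imports "HOL-Analysis.Analysis" begin

definition gph :: "('a \<Rightarrow> 'b set) \<Rightarrow> ('a \<times> 'b) set" where
  "gph T = {(x, v). v \<in> T x}"

definition inverse_op :: "('a \<Rightarrow> 'b set) \<Rightarrow> 'b \<Rightarrow> 'a set" where
  "inverse_op T v = {x. v \<in> T x}"

text \<open>Neighborhoods are not required to be open: a set is a neighborhood of each point of its
  interior.\<close>

definition nhd :: "'a::topological_space set \<Rightarrow> 'a \<Rightarrow> bool" where
  "nhd U x \<longleftrightarrow> x \<in> interior U"

definition locally_closed_around :: "'a::topological_space set \<Rightarrow> 'a \<Rightarrow> bool" where
  "locally_closed_around \<Omega> z \<longleftrightarrow> (\<exists>W. nhd W z \<and> closed W \<and> closed (\<Omega> \<inter> W))"

definition monotone_op :: "('a::real_inner \<Rightarrow> 'a set) \<Rightarrow> bool" where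
  "monotone_op S \<longleftrightarrow>
     (\<forall>(u1, v1) \<in> gph S. \<forall>(u2, v2) \<in> gph S. (v1 - v2) \<bullet> (u1 - u2) \<ge> 0)"

definition loc_strongly_max_monotone ::
    "('a::real_inner \<Rightarrow> 'a set) \<Rightarrow> 'a \<Rightarrow> 'a \<Rightarrow> real \<Rightarrow> bool" where
  "loc_strongly_max_monotone T x v \<kappa> \<longleftrightarrow> \<kappa> > 0 \<and>
     (\<exists>U V. nhd U x \<and> nhd V v \<and>
        (\<forall>(u1, v1) \<in> gph T \<inter> (U \<times> V). \<forall>(u2, v2) \<in> gph T \<inter> (U \<times> V).
            (v1 - v2) \<bullet> (u1 - u2) \<ge> \<kappa> * (norm (u1 - u2))\<^sup>2) \<and>
        (\<forall>S. monotone_op S \<longrightarrow> gph T \<inter> (U \<times> V) \<subseteq> gph S \<longrightarrow>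
            gph T \<inter> (U \<times> V) = gph S \<inter> (U \<times> V)))"

definition hypomonotone_around ::
    "('a::real_inner \<Rightarrow> 'a set) \<Rightarrow> 'a \<Rightarrow> 'a \<Rightarrow> bool" where
  "hypomonotone_around T x v \<longleftrightarrow>
     (\<exists>U V r. nhd U x \<and> nhd V v \<and> r > 0 \<and>
        (\<forall>(u1, v1) \<in> gph T \<inter> (U \<times> V). \<forall>(u2, v2) \<in> gph T \<inter> (U \<times> V).
            (v1 - v2) \<bullet> (u1 - u2) \<ge> - r * (norm (u1 - u2))\<^sup>2))"

text \<open>The limit superior is taken in the extended reals along \<open>z \<rightarrow> zb\<close> with \<open>z \<in> \<Omega>\<close> and
  \<open>z \<noteq> zb\<close>; at an isolated point of \<open>\<Omega>\<close> it is \<open>-\<infinity>\<close>, so the cone is then the whole space.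
  It is meant for \<open>zb \<in> \<Omega>\<close> only.\<close>

definition regular_normal_cone :: "'a::real_inner set \<Rightarrow> 'a \<Rightarrow> 'a set" where
  "regular_normal_cone \<Omega> zb =
     {\<zeta>. Limsup (at zb within \<Omega>) (\<lambda>z. ereal (\<zeta> \<bullet> (z - zb) / norm (z - zb))) \<le> 0}"

definition regular_coderivative ::
    "('a::real_inner \<Rightarrow> 'a set) \<Rightarrow> 'a \<Rightarrow> 'a \<Rightarrow> 'a \<Rightarrow> 'a set" where
  "regular_coderivative T u v w = {z. (z, - w) \<in> regular_normal_cone (gph T) (u, v)}"

definition strongly_metrically_regular ::
    "('a::real_inner \<Rightarrow> 'a set) \<Rightarrow> 'a \<Rightarrow> 'a \<Rightarrow> real \<Rightarrow> bool" where
  "strongly_metrically_regular T x v \<mu> \<longleftrightarrow> \<mu> > 0 \<and>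
     (\<exists>V U \<theta>. nhd V v \<and> nhd U x \<and> \<theta> ` V \<subseteq> U \<and>
        gph (inverse_op T) \<inter> (V \<times> U) = (\<lambda>y. (y, \<theta> y)) ` V \<and>
        \<mu>-lipschitz_on V \<theta>)"

end

theory Submission imports Defs begin

text \<open>
  Both conditions, and strong metric regularity, are compared with one property
  (\<open>strongly_monotone_onto\<close>): near \<open>(xb, vb)\<close> the graph is strongly monotone with modulus \<open>\<kappa>\<close> and \<open>T\<close>
  attains all values close to \<open>vb\<close>. The algebraic key is that \<open>\<kappa>|a|\<^sup>2 \<le> b \<bullet> a\<close> means
  \<open>|2\<kappa>a - b| \<le> |b|\<close>, so strong monotonicity of \<open>T\<close> is nonexpansiveness of \<open>2\<kappa>T\<^sup>-\<^sup>1 - I\<close>.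

  Maximality gives surjectivity because a nonexpansive map on any subset of a Hilbert space extends
  to one more point (\<open>kirszbraun_point\<close>); conversely surjectivity gives maximality by Minty's
  perturbation argument. The bound on the regular coderivative follows from the property by
  testing a normal against the change of the inverse along a ray of values in one well-chosen
  direction.

  The remaining implication, from the coderivative bound and hypomonotonicity to the property, is
  an integration of infinitesimal information. After a shift \<open>T + sI\<close> has a local Lipschitz inverse
  on a closed set \<open>D\<close>, and the bound controls the proximal subgradients of the scalarisations of
  \<open>2(\<kappa> + s)(T + sI)\<^sup>-\<^sup>1 - I\<close>. A mean value inequality (\<open>mean_value_proximal\<close>), based on a smooth
  variational principle, gives at the same time that \<open>D\<close> contains a ball and that this map is
  nonexpansive there. This argument is run once with a large shift, to obtain monotonicity with
  the right modulus, and once with no shift, to obtain surjectivity of \<open>T\<close>.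
\<close>

section \<open>Strong monotonicity as nonexpansiveness\<close>

text \<open>
  Completing the square: strong monotonicity of a relation says that its Cayley transform
  \<open>v \<mapsto> 2\<kappa>u - v\<close> is nonexpansive. The extension by one point, the
  coderivative estimate and the mean value argument all work with this form.
\<close>

lemma strongly_monotone_iff_nonexpansive:
  fixes a b :: "'a::real_inner"
  assumes "\<kappa> > 0"
  shows "\<kappa> * (norm a)\<^sup>2 \<le> b \<bullet> a \<longleftrightarrow> norm ((2 * \<kappa>) *\<^sub>R a - b) \<le> norm b"
proof -
  have "(norm ((2 * \<kappa>) *\<^sub>R a - b))\<^sup>2 = (norm b)\<^sup>2 + 4 * \<kappa> * (\<kappa> * (norm a)\<^sup>2 - b \<bullet> a)"
    unfolding power2_norm_eq_inner
    by (simp add: inner_diff_left inner_diff_right inner_commute algebra_simps)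
  moreover have "norm ((2 * \<kappa>) *\<^sub>R a - b) \<le> norm b \<longleftrightarrow> (norm ((2 * \<kappa>) *\<^sub>R a - b))\<^sup>2 \<le> (norm b)\<^sup>2"
    by (simp add: abs_le_square_iff[symmetric])
  ultimately show ?thesis
    using assms by (simp add: mult_le_0_iff)
qed

text \<open>
  The modulus may be negative, so that hypomonotonicity is covered as well.
\<close>

definition strongly_monotone_set :: "real \<Rightarrow> ('a::real_inner \<times> 'a) set \<Rightarrow> bool" where
  "strongly_monotone_set \<kappa> G \<longleftrightarrow>
     (\<forall>(u1, v1) \<in> G. \<forall>(u2, v2) \<in> G. \<kappa> * (norm (u1 - u2))\<^sup>2 \<le> (v1 - v2) \<bullet> (u1 - u2))"

lemma strongly_monotone_setD:
  assumes "strongly_monotone_set \<kappa> G" "(u1, v1) \<in> G" "(u2, v2) \<in> G"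
  shows "\<kappa> * (norm (u1 - u2))\<^sup>2 \<le> (v1 - v2) \<bullet> (u1 - u2)"
  using assms unfolding strongly_monotone_set_def by fast

lemma strongly_monotone_inverse_lipschitz:
  fixes a b :: "'a::real_inner"
  assumes "\<kappa> > 0" "\<kappa> * (norm a)\<^sup>2 \<le> b \<bullet> a"
  shows "norm a \<le> norm b / \<kappa>"
proof (cases "a = 0")
  case False
  have "norm a * (\<kappa> * norm a) \<le> norm a * norm b"
    using assms(2) norm_cauchy_schwarz[of b a] by (simp add: power2_eq_square mult.commute mult.left_commute)
  then show ?thesis using False assms(1) by (simp add: field_simps)
qed (use assms in simp)

section \<open>Extension of nonexpansive relations by one point\<close>

text \<open>
  The value of the dual problem is nonpositive. For points of the generating set the bound is an
  equality; for a convex combination it is the weighted average of the inequalities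
  \<open>|q - q'|\<^sup>2 \<le> |w - w'|\<^sup>2\<close> over all pairs.
\<close>

lemma kirszbraun_point_hull_bound:
  fixes A :: "('a::real_inner \<times> 'a) set"
  defines "K \<equiv> convex hull ((\<lambda>(w, q). (w, q, (norm q)\<^sup>2 - (norm w)\<^sup>2)) ` A)"
  assumes nonexp: "\<And>w q w' q'. (w, q) \<in> A \<Longrightarrow> (w', q') \<in> A \<Longrightarrow> norm (q - q') \<le> norm (w - w')"
    and "(w, q, s) \<in> K"
  shows "s \<le> (norm q)\<^sup>2 - (norm w)\<^sup>2"
proof -
  define P where "P = (\<lambda>(w, q). (w, q, (norm q)\<^sup>2 - (norm w)\<^sup>2)) ` A"
  have K: "K = convex hull P" by (simp add: K_def P_def)
  \<comment> \<open>The inequality to be shown is quadratic in the triple, but its polarised form is affine in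
    each of two triples separately, so it spreads from the generators to the hull one argument at
    a time.\<close>
  have half: "convex {(w', q', s'). s' + s - 2 * (q' \<bullet> q) + 2 * (w' \<bullet> w) \<le> 0}"
    for w q :: 'a and s :: real
  proof -
    have "{(w', q', s'). s' + s - 2 * (q' \<bullet> q) + 2 * (w' \<bullet> w) \<le> 0} =
        {k. (2 *\<^sub>R w, - 2 *\<^sub>R q, 1::real) \<bullet> k \<le> - s}"
      by (auto simp: inner_commute)
    then show ?thesis
      by (simp only: convex_halfspace_le)
  qed
  have pts: "s' + s - 2 * (q' \<bullet> q) + 2 * (w' \<bullet> w) \<le> 0"
    if "(w, q, s) \<in> P" "(w', q', s') \<in> P" for w q s w' q' s'
  proof -
    have "(norm (q' - q))\<^sup>2 \<le> (norm (w' - w))\<^sup>2"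
      using that nonexp by (intro power_mono) (auto simp: P_def)
    then show ?thesis
      using that unfolding P_def power2_norm_eq_inner
      by (auto simp: inner_diff_left inner_diff_right inner_commute power2_norm_eq_inner)
  qed
  have one: "s' + s - 2 * (q' \<bullet> q) + 2 * (w' \<bullet> w) \<le> 0"
    if "(w, q, s) \<in> P" "(w', q', s') \<in> K" for w q s w' q' s'
  proof -
    have "K \<subseteq> {(w', q', s'). s' + s - 2 * (q' \<bullet> q) + 2 * (w' \<bullet> w) \<le> 0}"
      unfolding K by (rule hull_minimal) (use pts[OF that(1)] half in auto)
    then show ?thesis using that(2) by auto
  qed
  have "K \<subseteq> {(w', q', s'). s' + s - 2 * (q' \<bullet> q) + 2 * (w' \<bullet> w) \<le> 0}"
  proof -
    have "s' + s - 2 * (q' \<bullet> q) + 2 * (w' \<bullet> w) \<le> 0" if "(w', q', s') \<in> P" for w' q' s'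
      using one[OF that \<open>(w, q, s) \<in> K\<close>] by (simp add: inner_commute add.commute)
    then show ?thesis
      unfolding K by (intro hull_minimal half) auto
  qed
  with \<open>(w, q, s) \<in> K\<close> show ?thesis
    by (auto simp: power2_norm_eq_inner)
qed

text \<open>
  Kirszbraun's theorem for one additional point, placed at the origin: a nonexpansive relation
  extends to \<open>0\<close>. The point \<open>p\<close> solves the minimax problem for \<open>|p - q|\<^sup>2 - |w|\<^sup>2\<close>. Working with a
  maximising sequence of the strongly concave dual problem replaces the usual compactness arguments
  (finite subfamilies and weak compactness of balls), so that completeness is all that is used.
\<close>

lemma kirszbraun_point:
  fixes A :: "('a::{real_inner, complete_space} \<times> 'a) set"
  assumes "A \<noteq> {}"
    and nonexp: "\<And>w q w' q'. (w, q) \<in> A \<Longrightarrow> (w', q') \<in> A \<Longrightarrow> norm (q - q') \<le> norm (w - w')"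
  shows "\<exists>p. \<forall>(w, q) \<in> A. norm (p - q) \<le> norm w"
proof -
  define K where "K = convex hull ((\<lambda>(w, q). (w, q, (norm q)\<^sup>2 - (norm w)\<^sup>2)) ` A)"
  \<comment> \<open>The supremum of the concave function G over K is the value of a maximin problem; the
    q-components of a maximising sequence converge to the point that is sought.\<close>
  define G :: "'a \<times> 'a \<times> real \<Rightarrow> real" where "G = (\<lambda>(w, q, s). s - (norm q)\<^sup>2)"
  define M where "M = (SUP k\<in>K. G k)"
  have "K \<noteq> {}" using assms(1) by (auto simp: K_def)
  have "convex K" by (simp add: K_def)
  have G0: "G k \<le> 0" if "k \<in> K" for k
  proof -
    obtain w q s where "k = (w, q, s)" by (metis prod.collapse)
    with that have "s \<le> (norm q)\<^sup>2 - (norm w)\<^sup>2"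
      unfolding K_def by (auto intro: kirszbraun_point_hull_bound nonexp)
    then have "s \<le> (norm q)\<^sup>2" using zero_le_power2[of "norm w"] by linarith
    then show ?thesis by (simp add: G_def \<open>k = _\<close>)
  qed
  have bdd: "bdd_above (G ` K)" using G0 by (intro bdd_aboveI2)
  have GM: "G k \<le> M" if "k \<in> K" for k
    unfolding M_def by (rule cSUP_upper[OF that bdd])
  define \<delta> where "\<delta> n = inverse (real (Suc n))" for n
  have \<delta>_mono: "\<delta> n \<le> \<delta> N" if "N \<le> n" for n N
    using that by (simp add: \<delta>_def)
  have "\<exists>k\<in>K. M - \<delta> n < G k" for n
  proof -
    have "M - \<delta> n < M" by (simp add: \<delta>_def)
    then show ?thesis
      unfolding M_def using less_cSUP_iff[OF \<open>K \<noteq> {}\<close> bdd] by blast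
  qed
  then obtain k where kK: "k n \<in> K" and kM: "M - \<delta> n < G (k n)" for n
    by metis
  define qn where "qn n = fst (snd (k n))" for n
  \<comment> \<open>G is strongly concave in q: its value at a midpoint exceeds the mean of the two values by a
    quarter of the squared distance, so two near maximisers have nearly the same q.\<close>
  have close: "(norm (qn m - qn n))\<^sup>2 \<le> 2 * (\<delta> m + \<delta> n)" for m n
  proof -
    obtain w q s where m: "k m = (w, q, s)" by (metis prod.collapse)
    obtain w' q' s' where n: "k n = (w', q', s')" by (metis prod.collapse)
    have "(1/2) *\<^sub>R k m + (1/2) *\<^sub>R k n \<in> K"
      using \<open>convex K\<close> kK by (intro convexD) auto
    from GM[OF this] have "s / 2 + s' / 2 - (norm ((1/2) *\<^sub>R q + (1/2) *\<^sub>R q'))\<^sup>2 \<le> M"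
      by (simp add: m n G_def)
    moreover have "M - \<delta> m < s - (norm q)\<^sup>2" "M - \<delta> n < s' - (norm q')\<^sup>2"
      using kM[of m] kM[of n] by (simp_all add: m n G_def)
    moreover have "(norm ((1/2) *\<^sub>R q + (1/2) *\<^sub>R q'))\<^sup>2 = (norm q)\<^sup>2 / 2 + (norm q')\<^sup>2 / 2 - (norm (q - q'))\<^sup>2 / 4"
      unfolding power2_norm_eq_inner
      by (simp add: inner_diff_left inner_diff_right inner_add_left inner_add_right inner_commute field_simps)
    ultimately show ?thesis
      unfolding qn_def m n by simp
  qed
  have lim0: "\<delta> \<longlonglongrightarrow> 0" unfolding \<delta>_def by (rule LIMSEQ_inverse_real_of_nat)
  have "Cauchy qn"
  proof (rule metric_CauchyI)
    fix e :: real assume "e > 0"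
    then obtain N where N: "\<delta> N < e\<^sup>2 / 4"
      using reals_Archimedean[of "e\<^sup>2 / 4"] by (auto simp: \<delta>_def)
    have "dist (qn m) (qn n) < e" if "m \<ge> N" "n \<ge> N" for m n
    proof -
      have "(norm (qn m - qn n))\<^sup>2 < e\<^sup>2"
        using order.strict_trans1[OF close[of m n], of "e\<^sup>2"] N \<delta>_mono[OF that(1)] \<delta>_mono[OF that(2)]
        by simp
      then show ?thesis
        using \<open>e > 0\<close> by (simp add: dist_norm power2_less_imp_less)
    qed
    then show "\<exists>N. \<forall>m\<ge>N. \<forall>n\<ge>N. dist (qn m) (qn n) < e" by blast
  qed
  then obtain p where p: "qn \<longlonglongrightarrow> p" using Cauchy_convergent convergent_def by blast
  have "norm (p - q) \<le> norm w" if wq: "(w, q) \<in> A" for w q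
  proof -
    \<comment> \<open>First-order optimality of the near maximiser k n in the direction of the generator of (w, q).\<close>
    have step: "t * ((norm (q - qn n))\<^sup>2 - (norm w)\<^sup>2) \<le> \<delta> n + t\<^sup>2 * (norm (q - qn n))\<^sup>2"
      if t: "0 < t" "t \<le> 1" for t n
    proof -
      obtain w' q' s where n: "k n = (w', q', s)" by (metis prod.collapse)
      have "(w, q, (norm q)\<^sup>2 - (norm w)\<^sup>2) \<in> K"
        unfolding K_def by (rule hull_inc) (use wq in force)
      then have "(1 - t) *\<^sub>R k n + t *\<^sub>R (w, q, (norm q)\<^sup>2 - (norm w)\<^sup>2) \<in> K"
        using \<open>convex K\<close> kK t by (intro convexD) auto
      from GM[OF this] have "(1 - t) * s + t * ((norm q)\<^sup>2 - (norm w)\<^sup>2) - (norm ((1 - t) *\<^sub>R q' + t *\<^sub>R q))\<^sup>2 \<le> M"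
        by (simp add: n G_def)
      moreover have "(norm ((1 - t) *\<^sub>R q' + t *\<^sub>R q))\<^sup>2
          = (1 - t) * (norm q')\<^sup>2 + t * (norm q)\<^sup>2 - t * (norm (q - q'))\<^sup>2 + t\<^sup>2 * (norm (q - q'))\<^sup>2"
        unfolding power2_norm_eq_inner
        by (simp add: inner_diff_left inner_diff_right inner_add_left inner_add_right inner_commute
            power2_eq_square algebra_simps)
      moreover have "M - \<delta> n < s - (norm q')\<^sup>2" "t * (s - (norm q')\<^sup>2) \<le> 0"
        using kM[of n] G0[OF kK[of n]] t by (simp_all add: n G_def mult_le_0_iff)
      ultimately show ?thesis
        unfolding qn_def n by (simp add: algebra_simps)
    qed
    have "(norm (q - p))\<^sup>2 - (norm w)\<^sup>2 \<le> t * (norm (q - p))\<^sup>2" if t: "0 < t" "t \<le> 1" for t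
    proof -
      have "t * ((norm (q - p))\<^sup>2 - (norm w)\<^sup>2) \<le> 0 + t\<^sup>2 * (norm (q - p))\<^sup>2"
      proof (rule LIMSEQ_le)
        show "(\<lambda>n. t * ((norm (q - qn n))\<^sup>2 - (norm w)\<^sup>2)) \<longlonglongrightarrow> t * ((norm (q - p))\<^sup>2 - (norm w)\<^sup>2)"
          by (intro tendsto_intros p)
        show "(\<lambda>n. \<delta> n + t\<^sup>2 * (norm (q - qn n))\<^sup>2) \<longlonglongrightarrow> 0 + t\<^sup>2 * (norm (q - p))\<^sup>2"
          by (intro tendsto_intros p lim0)
      qed (use step[OF t] in blast)
      then have "t * ((norm (q - p))\<^sup>2 - (norm w)\<^sup>2) \<le> t * (t * (norm (q - p))\<^sup>2)"
        by (simp add: power2_eq_square mult.assoc)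
      then show ?thesis using t by simp
    qed
    note small = this
    have "(norm (q - p))\<^sup>2 - (norm w)\<^sup>2 \<le> 0"
    proof (rule tendsto_lowerbound)
      show "((\<lambda>t. t * (norm (q - p))\<^sup>2) \<longlongrightarrow> 0) (at_right 0)"
        by (auto intro!: tendsto_eq_intros)
      show "\<forall>\<^sub>F t in at_right 0. (norm (q - p))\<^sup>2 - (norm w)\<^sup>2 \<le> t * (norm (q - p))\<^sup>2"
        unfolding eventually_at_right_field using small by (intro exI[of _ 1]) auto
    qed simp
    then show ?thesis
      using power2_le_imp_le[of "norm (q - p)" "norm w"] by (simp add: norm_minus_commute)
  qed
  then show ?thesis by blast
qed

text \<open>
  The local form of Minty's theorem: any \<open>y\<close> can be added to the range of a strongly monotone set
  without losing strong monotonicity, by extending the Cayley transform to \<open>y\<close>.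
\<close>

lemma strongly_monotone_add_point:
  fixes G :: "('a::{real_inner, complete_space} \<times> 'a) set"
  assumes "\<kappa> > 0" "G \<noteq> {}" "strongly_monotone_set \<kappa> G"
  shows "\<exists>u. strongly_monotone_set \<kappa> (insert (u, y) G)"
proof -
  let ?A = "{(w - y, (2 * \<kappa>) *\<^sub>R x - w) | x w. (x, w) \<in> G}"
  have nonexp: "norm ((2 * \<kappa>) *\<^sub>R x - v - ((2 * \<kappa>) *\<^sub>R x' - v')) \<le> norm (v - y - (v' - y))"
    if "(x, v) \<in> G" "(x', v') \<in> G" for x v x' v'
  proof -
    have "norm ((2 * \<kappa>) *\<^sub>R (x - x') - (v - v')) \<le> norm (v - v')"
      using strongly_monotone_setD[OF assms(3) that]
      by (simp add: strongly_monotone_iff_nonexpansive[OF assms(1)])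
    then show ?thesis by (simp add: algebra_simps)
  qed
  have "\<exists>p. \<forall>(w, q) \<in> ?A. norm (p - q) \<le> norm w"
  proof (rule kirszbraun_point)
    show "?A \<noteq> {}" using assms(2) by auto
    show "norm (q - q') \<le> norm (w - w')" if "(w, q) \<in> ?A" "(w', q') \<in> ?A" for w q w' q'
      using that by clarify (rule nonexp)
  qed
  then obtain p where p: "norm (p - ((2 * \<kappa>) *\<^sub>R x - w)) \<le> norm (w - y)" if "(x, w) \<in> G" for x w
    by fast
  define u where "u = inverse (2 * \<kappa>) *\<^sub>R (p + y)"
  have u: "(2 * \<kappa>) *\<^sub>R u = p + y" using assms(1) by (simp add: u_def)
  have new: "\<kappa> * (norm (u - x))\<^sup>2 \<le> (y - w) \<bullet> (u - x)" if "(x, w) \<in> G" for x w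
  proof -
    have eq: "(2 * \<kappa>) *\<^sub>R (u - x) - (y - w) = p - ((2 * \<kappa>) *\<^sub>R x - w)"
      by (simp add: scaleR_diff_right u)
    show ?thesis
      unfolding strongly_monotone_iff_nonexpansive[OF assms(1)] eq
      using p[OF that] by (simp add: norm_minus_commute)
  qed
  have new': "\<kappa> * (norm (x - u))\<^sup>2 \<le> (w - y) \<bullet> (x - u)" if "(x, w) \<in> G" for x w
    using new[OF that] by (simp add: norm_minus_commute inner_diff_left inner_diff_right)
  show ?thesis
    using assms(3) new new' unfolding strongly_monotone_set_def by (intro exI[of _ u]) auto
qed

section \<open>Local maximality and local surjectivity\<close>

text \<open>
  The pivot of the whole proof: near the reference point \<open>T\<close> is strongly monotone and takes every
  value close to \<open>v\<close>. This is maximality in the form in which it can be both produced and used.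
\<close>

definition strongly_monotone_onto ::
    "('a::real_inner \<Rightarrow> 'a set) \<Rightarrow> 'a \<Rightarrow> 'a \<Rightarrow> real \<Rightarrow> bool" where
  "strongly_monotone_onto T x v \<kappa> \<longleftrightarrow>
     (\<exists>U V. open U \<and> open V \<and> x \<in> U \<and> v \<in> V \<and>
        strongly_monotone_set \<kappa> (gph T \<inter> U \<times> V) \<and> (\<forall>y\<in>V. \<exists>u\<in>U. (u, y) \<in> gph T))"

text \<open>
  A value \<open>y\<close> near \<open>v\<close> is added to the graph at some \<open>u\<close>; strong monotonicity keeps \<open>u\<close> within
  \<open>|y - v| / \<kappa>\<close> of \<open>x\<close>, hence in the given neighborhood, and maximality then forces \<open>(u, y)\<close> to have
  been in the graph already.
\<close>

lemma onto_of_loc_strongly_max_monotone: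
  fixes T :: "'a::{real_inner, complete_space} \<Rightarrow> 'a set"
  assumes "loc_strongly_max_monotone T x v \<kappa>" and xv: "(x, v) \<in> gph T"
  shows "strongly_monotone_onto T x v \<kappa>"
proof -
  obtain U V where "\<kappa> > 0" and nhd: "nhd U x" "nhd V v"
    and mono: "strongly_monotone_set \<kappa> (gph T \<inter> U \<times> V)"
    and max: "\<And>S. monotone_op S \<Longrightarrow> gph T \<inter> (U \<times> V) \<subseteq> gph S \<Longrightarrow> gph T \<inter> (U \<times> V) = gph S \<inter> (U \<times> V)"
    using assms(1) unfolding loc_strongly_max_monotone_def strongly_monotone_set_def by blast
  obtain e1 e2 where "e1 > 0" "ball x e1 \<subseteq> U" "e2 > 0" "ball v e2 \<subseteq> V"
    using nhd unfolding nhd_def mem_interior by blast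
  define \<rho> where "\<rho> = min e2 (\<kappa> * e1)"
  have "\<rho> > 0" using \<open>e1 > 0\<close> \<open>e2 > 0\<close> \<open>\<kappa> > 0\<close> by (simp add: \<rho>_def)
  have UV: "ball x e1 \<subseteq> U" "ball v \<rho> \<subseteq> V"
    using \<open>ball x e1 \<subseteq> U\<close> \<open>ball v e2 \<subseteq> V\<close> by (auto simp: \<rho>_def)
  have xvG: "(x, v) \<in> gph T \<inter> U \<times> V"
    using xv UV \<open>e1 > 0\<close> \<open>\<rho> > 0\<close> by auto
  have "\<exists>u\<in>ball x e1. (u, y) \<in> gph T" if y: "y \<in> ball v \<rho>" for y
  proof -
    obtain u where u: "strongly_monotone_set \<kappa> (insert (u, y) (gph T \<inter> U \<times> V))"
      using strongly_monotone_add_point[OF \<open>\<kappa> > 0\<close> _ mono] xvG by blast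
    have "norm (x - u) \<le> norm (v - y) / \<kappa>"
      by (rule strongly_monotone_inverse_lipschitz[OF \<open>\<kappa> > 0\<close> strongly_monotone_setD[OF u]])
        (use xvG in auto)
    also have "\<dots> < e1"
      using y \<open>\<kappa> > 0\<close> by (simp add: \<rho>_def dist_norm field_simps)
    finally have ub: "u \<in> ball x e1" by (simp add: dist_norm)
    define S where "S x' = {w. (x', w) \<in> insert (u, y) (gph T \<inter> U \<times> V)}" for x'
    have gS: "gph S = insert (u, y) (gph T \<inter> U \<times> V)"
      by (auto simp: gph_def S_def)
    have "(v1 - v2) \<bullet> (u1 - u2) \<ge> 0" if "(u1, v1) \<in> gph S" "(u2, v2) \<in> gph S" for u1 v1 u2 v2
    proof -
      have "\<kappa> * (norm (u1 - u2))\<^sup>2 \<le> (v1 - v2) \<bullet> (u1 - u2)"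
        using strongly_monotone_setD[OF u] that unfolding gS by blast
      moreover have "0 \<le> \<kappa> * (norm (u1 - u2))\<^sup>2" using \<open>\<kappa> > 0\<close> by simp
      ultimately show ?thesis by linarith
    qed
    then have "monotone_op S" unfolding monotone_op_def by blast
    then have "gph T \<inter> (U \<times> V) = gph S \<inter> (U \<times> V)"
      by (rule max) (auto simp: gS)
    moreover have "(u, y) \<in> gph S \<inter> (U \<times> V)"
      using ub y UV by (auto simp: gS)
    ultimately show ?thesis using ub by blast
  qed
  moreover have "strongly_monotone_set \<kappa> (gph T \<inter> ball x e1 \<times> ball v \<rho>)"
    using mono UV unfolding strongly_monotone_set_def by fast
  ultimately show ?thesis
    unfolding strongly_monotone_onto_def using \<open>e1 > 0\<close> \<open>\<rho> > 0\<close>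
    by (intro exI[of _ "ball x e1"] exI[of _ "ball v \<rho>"]) simp
qed

text \<open>
  Minty's argument: the local inverse of \<open>T\<close> is continuous and defined at all values close to the
  given one, so a point that is monotonically related to the graph must lie on it.
\<close>

lemma loc_strongly_max_monotone_of_onto:
  fixes T :: "'a::real_inner \<Rightarrow> 'a set"
  assumes "\<kappa> > 0" "strongly_monotone_onto T x v \<kappa>"
  shows "loc_strongly_max_monotone T x v \<kappa>"
proof -
  obtain U V where op: "open U" "open V" "x \<in> U" "v \<in> V"
    and mono: "strongly_monotone_set \<kappa> (gph T \<inter> U \<times> V)"
    and onto: "\<forall>y\<in>V. \<exists>u\<in>U. (u, y) \<in> gph T"
    using assms(2) unfolding strongly_monotone_onto_def by blast
  have "(u, w) \<in> gph T"
    if S: "monotone_op S" "gph T \<inter> (U \<times> V) \<subseteq> gph S" and uw: "(u, w) \<in> gph S" "u \<in> U" "w \<in> V" for S u w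
  proof -
    obtain a where a: "a \<in> U" "(a, w) \<in> gph T" using onto uw by blast
    obtain e where e: "e > 0" "ball w e \<subseteq> V" using op uw(3) openE by blast
    \<comment> \<open>Moving the value w by t in the direction d changes the preimage by O(t) only, while
      monotonicity bounds (norm d)^2 by the inner product of d with that change.\<close>
    define d where "d = u - a"
    have "(norm d)\<^sup>2 \<le> t * (norm d * norm d / \<kappa>)" if t: "0 < t" "t < e / (norm d + 1)" for t
    proof -
      have "t * norm d \<le> t * (norm d + 1)" using t by simp
      also have "\<dots> < e" using t by (simp add: pos_less_divide_eq add_nonneg_pos)
      finally have "w + t *\<^sub>R d \<in> V" using e t by (intro subsetD[OF e(2)]) (simp add: dist_norm)
      then obtain b where b: "b \<in> U" "(b, w + t *\<^sub>R d) \<in> gph T" using onto by blast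
      have "(w + t *\<^sub>R d - w) \<bullet> (b - u) \<ge> 0"
        using S uw b \<open>w + t *\<^sub>R d \<in> V\<close> unfolding monotone_op_def by fast
      then have "0 \<le> d \<bullet> (b - u)" using t by (simp add: zero_le_mult_iff)
      moreover have "norm (b - a) \<le> norm (w + t *\<^sub>R d - w) / \<kappa>"
        by (rule strongly_monotone_inverse_lipschitz[OF \<open>\<kappa> > 0\<close> strongly_monotone_setD[OF mono]])
          (use a b uw \<open>w + t *\<^sub>R d \<in> V\<close> in auto)
      moreover have "d \<bullet> (b - u) = d \<bullet> (b - a) - (norm d)\<^sup>2"
        unfolding power2_norm_eq_inner by (simp add: d_def inner_diff_right)
      moreover have "d \<bullet> (b - a) \<le> norm d * norm (b - a)" by (rule norm_cauchy_schwarz)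
      moreover have "norm d * norm (b - a) \<le> norm d * (t * norm d / \<kappa>)"
        using calculation(2) t by (intro mult_left_mono) auto
      ultimately show ?thesis by (simp add: algebra_simps)
    qed
    note small = this
    have "(norm d)\<^sup>2 \<le> 0"
    proof (rule tendsto_lowerbound)
      show "((\<lambda>t. t * (norm d * norm d / \<kappa>)) \<longlongrightarrow> 0) (at_right 0)"
        by (rule tendsto_eq_intros | simp)+
      show "\<forall>\<^sub>F t in at_right 0. (norm d)\<^sup>2 \<le> t * (norm d * norm d / \<kappa>)"
        unfolding eventually_at_right_field using small e(1)
        by (intro exI[of _ "e / (norm d + 1)"]) (auto simp: add_nonneg_pos)
    qed simp
    then have "u = a" by (simp add: d_def)
    with a show ?thesis by simp
  qed
  then have max: "gph T \<inter> (U \<times> V) = gph S \<inter> (U \<times> V)"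
    if "monotone_op S" "gph T \<inter> (U \<times> V) \<subseteq> gph S" for S
    using that by blast
  show ?thesis
    unfolding loc_strongly_max_monotone_def
  proof (rule conjI[OF assms(1)], rule exI[of _ U], rule exI[of _ V], intro conjI)
    show "nhd U x" "nhd V v" using op by (simp_all add: nhd_def interior_open)
  qed (use mono max in \<open>auto simp: strongly_monotone_set_def\<close>)
qed

lemma strongly_metrically_regular_of_onto:
  fixes T :: "'a::real_inner \<Rightarrow> 'a set"
  assumes "\<kappa> > 0" "strongly_monotone_onto T x v \<kappa>"
  shows "strongly_metrically_regular T x v (inverse \<kappa>)"
proof -
  obtain U V where op: "open U" "open V" "x \<in> U" "v \<in> V"
    and mono: "strongly_monotone_set \<kappa> (gph T \<inter> U \<times> V)"
    and onto: "\<forall>y\<in>V. \<exists>u\<in>U. (u, y) \<in> gph T"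
    using assms(2) unfolding strongly_monotone_onto_def by blast
  obtain \<theta> where \<theta>: "\<theta> y \<in> U" "(\<theta> y, y) \<in> gph T" if "y \<in> V" for y
    using onto by metis
  have lip: "norm (a - b) \<le> norm (y - y') / \<kappa>"
    if "a \<in> U" "(a, y) \<in> gph T" "y \<in> V" "b \<in> U" "(b, y') \<in> gph T" "y' \<in> V" for a b y y'
    by (rule strongly_monotone_inverse_lipschitz[OF \<open>\<kappa> > 0\<close> strongly_monotone_setD[OF mono]])
      (use that in auto)
  have "a = \<theta> y" if "a \<in> U" "(a, y) \<in> gph T" "y \<in> V" for a y
    using lip[OF that \<theta>[OF that(3)] that(3)] by simp
  then have "gph (inverse_op T) \<inter> (V \<times> U) = (\<lambda>y. (y, \<theta> y)) ` V"
    using \<theta> by (auto simp: gph_def inverse_op_def)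
  moreover have "(inverse \<kappa>)-lipschitz_on V \<theta>"
    using assms(1) lip \<theta> by (intro lipschitz_onI) (auto simp: dist_norm field_simps)
  moreover have "\<theta> ` V \<subseteq> U" using \<theta> by auto
  ultimately show ?thesis
    unfolding strongly_metrically_regular_def nhd_def using op assms(1)
    by (intro conjI exI[of _ V] exI[of _ U] exI[of _ \<theta>]) (auto simp: interior_open)
qed

section \<open>Regular normals and coderivatives\<close>

text \<open>
  The defining upper limit, without extended reals and with the quotient cleared.
\<close>

lemma regular_normal_cone_iff:
  fixes \<Omega> :: "'a::real_inner set"
  shows "\<zeta> \<in> regular_normal_cone \<Omega> zb \<longleftrightarrow>
    (\<forall>\<epsilon>>0. \<forall>\<^sub>F z in at zb within \<Omega>. \<zeta> \<bullet> (z - zb) \<le> \<epsilon> * norm (z - zb))"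
proof
  assume *: "\<zeta> \<in> regular_normal_cone \<Omega> zb"
  show "\<forall>\<epsilon>>0. \<forall>\<^sub>F z in at zb within \<Omega>. \<zeta> \<bullet> (z - zb) \<le> \<epsilon> * norm (z - zb)"
  proof (intro allI impI)
    fix \<epsilon> :: real assume "\<epsilon> > 0"
    then have "Limsup (at zb within \<Omega>) (\<lambda>z. ereal (\<zeta> \<bullet> (z - zb) / norm (z - zb))) < ereal \<epsilon>"
      using * by (auto simp: regular_normal_cone_def intro: le_less_trans)
    then have "\<forall>\<^sub>F z in at zb within \<Omega>. ereal (\<zeta> \<bullet> (z - zb) / norm (z - zb)) < ereal \<epsilon>"
      by (rule Limsup_lessD)
    then show "\<forall>\<^sub>F z in at zb within \<Omega>. \<zeta> \<bullet> (z - zb) \<le> \<epsilon> * norm (z - zb)"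
      using eventually_neq_at_within[of zb zb \<Omega>]
      by eventually_elim (auto simp: divide_less_eq less_imp_le)
  qed
next
  assume *: "\<forall>\<epsilon>>0. \<forall>\<^sub>F z in at zb within \<Omega>. \<zeta> \<bullet> (z - zb) \<le> \<epsilon> * norm (z - zb)"
  have "Limsup (at zb within \<Omega>) (\<lambda>z. ereal (\<zeta> \<bullet> (z - zb) / norm (z - zb))) \<le> 0"
  proof (rule ereal_le_epsilon2)
    fix \<epsilon> :: real assume "\<epsilon> > 0"
    have "\<forall>\<^sub>F z in at zb within \<Omega>. ereal (\<zeta> \<bullet> (z - zb) / norm (z - zb)) \<le> ereal \<epsilon>"
      using *[rule_format, OF \<open>\<epsilon> > 0\<close>] eventually_neq_at_within[of zb zb \<Omega>]
      by eventually_elim (auto simp: divide_le_eq)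
    then show "Limsup (at zb within \<Omega>) (\<lambda>z. ereal (\<zeta> \<bullet> (z - zb) / norm (z - zb))) \<le> 0 + ereal \<epsilon>"
      by (simp add: Limsup_bounded)
  qed
  then show "\<zeta> \<in> regular_normal_cone \<Omega> zb" by (simp add: regular_normal_cone_def)
qed

lemma proximal_normal_imp_regular:
  assumes "r > 0" "C \<ge> 0"
    and prox: "\<And>q. q \<in> \<Omega> \<Longrightarrow> dist q zb < r \<Longrightarrow> \<zeta> \<bullet> (q - zb) \<le> C * (norm (q - zb))\<^sup>2"
  shows "\<zeta> \<in> regular_normal_cone \<Omega> zb"
  unfolding regular_normal_cone_iff
proof (intro allI impI)
  fix \<epsilon> :: real assume "\<epsilon> > 0"
  have "\<zeta> \<bullet> (q - zb) \<le> \<epsilon> * norm (q - zb)" if q: "q \<in> \<Omega>" "dist q zb < min r (\<epsilon> / (C + 1))" for q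
  proof -
    have "(C + 1) * norm (q - zb) < \<epsilon>"
      using q(2) \<open>C \<ge> 0\<close> by (simp add: dist_norm pos_less_divide_eq mult.commute)
    then have "C * norm (q - zb) \<le> \<epsilon>" by (simp add: distrib_right) (smt (verit) norm_ge_zero)
    then have "C * norm (q - zb) * norm (q - zb) \<le> \<epsilon> * norm (q - zb)"
      by (rule mult_right_mono) simp
    then show ?thesis using prox[OF q(1)] q(2) by (simp add: power2_eq_square)
  qed
  then show "\<forall>\<^sub>F z in at zb within \<Omega>. \<zeta> \<bullet> (z - zb) \<le> \<epsilon> * norm (z - zb)"
    unfolding eventually_at using \<open>r > 0\<close> \<open>\<epsilon> > 0\<close> \<open>C \<ge> 0\<close>
    by (intro exI[of _ "min r (\<epsilon> / (C + 1))"]) auto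
qed

text \<open>
  By strong monotonicity the inverse moves by \<open>d\<close> with \<open>|2\<kappa>d - h| \<le> |h|\<close> when the value moves by
  \<open>h\<close>. Testing a normal \<open>(z, -w)\<close> with \<open>h\<close> a small positive multiple of \<open>z - 2\<kappa>w\<close> gives
  \<open>|z - 2\<kappa>w| \<le> |z|\<close>, which is the claim in its nonexpansive form.
\<close>

lemma coderivative_bound_of_onto:
  fixes T :: "'a::real_inner \<Rightarrow> 'a set"
  assumes "\<kappa> > 0" and op: "open U" "open V"
    and mono: "strongly_monotone_set \<kappa> (gph T \<inter> U \<times> V)"
    and onto: "\<forall>y\<in>V. \<exists>u\<in>U. (u, y) \<in> gph T"
    and uv: "(u, v) \<in> gph T \<inter> U \<times> V"
    and z: "z \<in> regular_coderivative T u v w"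
  shows "\<kappa> * (norm w)\<^sup>2 \<le> z \<bullet> w"
proof (cases "z = (2 * \<kappa>) *\<^sub>R w")
  case True
  then show ?thesis
    using assms(1) by (simp add: power2_norm_eq_inner)
next
  case False
  define g where "g = z - (2 * \<kappa>) *\<^sub>R w"
  have "norm g > 0" using False by (simp add: g_def)
  have "norm g \<le> norm z + \<epsilon>'" if "\<epsilon>' > 0" for \<epsilon>'
  proof -
    define \<epsilon> where "\<epsilon> = \<epsilon>' / (2 * (1 + \<kappa>))"
    have "\<epsilon> > 0" using that assms(1) by (simp add: \<epsilon>_def)
    then have "\<forall>\<^sub>F p in at (u, v) within gph T. (z, - w) \<bullet> (p - (u, v)) \<le> \<epsilon> * norm (p - (u, v))"
      using z unfolding regular_coderivative_def regular_normal_cone_iff by blast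
    then obtain e where "e > 0" and e: "\<And>p. p \<in> gph T \<Longrightarrow> p \<noteq> (u, v) \<Longrightarrow> dist p (u, v) < e \<Longrightarrow>
        (z, - w) \<bullet> (p - (u, v)) \<le> \<epsilon> * norm (p - (u, v))"
      unfolding eventually_at by blast
    obtain e' where "e' > 0" "ball v e' \<subseteq> V" using op uv openE by blast
    define \<rho> where "\<rho> = min e' (e / (1 / \<kappa> + 1))"
    have \<rho>: "\<rho> > 0" "\<rho> \<le> e'" "\<rho> \<le> e / (1 / \<kappa> + 1)"
      using \<open>e > 0\<close> \<open>e' > 0\<close> assms(1) by (auto simp: \<rho>_def add_pos_pos)
    \<comment> \<open>The step h along g makes the normal inequality sharp; its length keeps the displacement (d, h)
      inside the neighbourhood where that inequality holds.\<close>
    define t where "t = \<rho> / (2 * norm g)"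
    define h where "h = t *\<^sub>R g"
    have "t > 0" using \<rho> \<open>norm g > 0\<close> by (simp add: t_def)
    then have "norm h = \<rho> / 2" using \<open>norm g > 0\<close> by (simp add: h_def) (simp add: t_def)
    then have "norm h < e'" "norm h < e / (1 / \<kappa> + 1)" using \<rho> by simp_all
    then have h: "norm h < e'" "(1 / \<kappa> + 1) * norm h < e"
      using assms(1) by (auto simp: pos_less_divide_eq add_pos_pos mult.commute)
    have "v + h \<in> V" using \<open>ball v e' \<subseteq> V\<close> h by (auto simp: subset_iff dist_norm)
    then obtain u' where u': "u' \<in> U" "(u', v + h) \<in> gph T" using onto by blast
    define d where "d = u' - u"
    have mon: "\<kappa> * (norm d)\<^sup>2 \<le> h \<bullet> d"
      using strongly_monotone_setD[OF mono, of u' "v + h" u v] u' uv \<open>v + h \<in> V\<close> by (simp add: d_def)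
    have "norm ((2 * \<kappa>) *\<^sub>R d - h) \<le> norm h"
      using mon by (simp add: strongly_monotone_iff_nonexpansive[OF assms(1)])
    have "norm d \<le> norm h / \<kappa>" by (rule strongly_monotone_inverse_lipschitz[OF assms(1) mon])
    have nb: "norm (d, h) \<le> (1 / \<kappa> + 1) * norm h"
      using norm_Pair_le[of d h] \<open>norm d \<le> norm h / \<kappa>\<close> by (simp add: algebra_simps)
    have diff: "(u', v + h) - (u, v) = (d, h)" by (simp add: d_def)
    have "h \<noteq> 0" using \<open>norm g > 0\<close> \<open>t > 0\<close> by (simp add: h_def)
    have "(z, - w) \<bullet> (d, h) \<le> \<epsilon> * norm (d, h)"
      unfolding diff[symmetric]
    proof (rule e)
      show "dist (u', v + h) (u, v) < e" using nb h unfolding dist_norm diff by linarith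
    qed (use u' \<open>h \<noteq> 0\<close> in auto)
    also have "\<dots> \<le> \<epsilon> * ((1 / \<kappa> + 1) * norm h)" using nb \<open>\<epsilon> > 0\<close> by simp
    finally have up: "2 * \<kappa> * (z \<bullet> d - w \<bullet> h) \<le> 2 * \<kappa> * (\<epsilon> * ((1 / \<kappa> + 1) * norm h))"
      using assms(1) by simp
    have "2 * \<kappa> * (\<epsilon> * ((1 / \<kappa> + 1) * norm h)) = \<epsilon>' * norm h"
    proof -
      have "2 * \<kappa> * (\<epsilon> * ((1 / \<kappa> + 1) * norm h)) = 2 * (1 + \<kappa>) * \<epsilon> * norm h"
        using assms(1) by (simp add: field_simps)
      moreover have "2 * (1 + \<kappa>) * \<epsilon> = \<epsilon>'" using assms(1) by (simp add: \<epsilon>_def)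
      ultimately show ?thesis by (simp only:)
    qed
    with up have "2 * \<kappa> * (z \<bullet> d - w \<bullet> h) \<le> \<epsilon>' * norm h" by simp
    moreover have "2 * \<kappa> * (z \<bullet> d - w \<bullet> h) = z \<bullet> ((2 * \<kappa>) *\<^sub>R d - h) + g \<bullet> h"
      by (simp add: g_def inner_diff_left inner_diff_right algebra_simps)
    moreover have "\<bar>z \<bullet> ((2 * \<kappa>) *\<^sub>R d - h)\<bar> \<le> norm z * norm h"
      using Cauchy_Schwarz_ineq2[of z "(2 * \<kappa>) *\<^sub>R d - h"] \<open>norm ((2 * \<kappa>) *\<^sub>R d - h) \<le> norm h\<close>
      by (meson mult_left_mono norm_ge_zero order_trans)
    moreover have "g \<bullet> h = norm g * norm h"
      using \<open>t > 0\<close> by (simp add: h_def power2_norm_eq_inner[symmetric] power2_eq_square)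
    ultimately have "norm g * norm h \<le> (norm z + \<epsilon>') * norm h" by (simp add: algebra_simps abs_le_iff)
    then show ?thesis using \<open>h \<noteq> 0\<close> by simp
  qed
  then have "norm g \<le> norm z" by (rule field_le_epsilon)
  then show ?thesis
    by (simp add: strongly_monotone_iff_nonexpansive[OF assms(1)] g_def norm_minus_commute)
qed

section \<open>A smooth variational principle\<close>

lemma convergent_of_geometric_increments:
  fixes f :: "nat \<Rightarrow> 'a::complete_space"
  assumes "\<And>n. dist (f (Suc n)) (f n) \<le> C * (1/2) ^ n"
  shows "\<exists>l. f \<longlonglongrightarrow> l"
proof -
  have bound: "dist (f n) (f (n + k)) \<le> 2 * C * ((1/2) ^ n - (1/2) ^ (n + k))" for n k
  proof (induction k)
    case (Suc k)
    have "dist (f n) (f (n + Suc k)) \<le> dist (f n) (f (n + k)) + dist (f (Suc (n + k))) (f (n + k))"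
      using dist_triangle2[of "f n" "f (Suc (n + k))" "f (n + k)"] by (simp add: dist_commute)
    then show ?case using Suc assms[of "n + k"] by (simp add: algebra_simps)
  qed simp
  have "C \<ge> 0" using assms[of 0] by (simp add: order_trans[OF zero_le_dist])
  have le: "dist (f m) (f n) \<le> 2 * C * (1/2) ^ N" if mn: "N \<le> m" "m \<le> n" for m n N
  proof -
    have "dist (f m) (f n) \<le> 2 * C * ((1/2) ^ m - (1/2) ^ n)"
      using bound[of m "n - m"] mn by simp
    also have "\<dots> \<le> 2 * C * (1/2) ^ N"
    proof (intro mult_left_mono)
      have "(1/2) ^ m \<le> ((1/2) ^ N :: real)" using mn by (intro power_decreasing) auto
      then show "(1/2) ^ m - (1/2) ^ n \<le> ((1/2) ^ N :: real)" by (smt (verit) zero_le_power half_gt_zero)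
    qed (use \<open>C \<ge> 0\<close> in simp)
    finally show ?thesis .
  qed
  have "Cauchy f"
  proof (rule metric_CauchyI)
    fix e :: real assume "e > 0"
    obtain N where "(1/2) ^ N < e / (2 * C + 1)"
      using real_arch_pow_inv[of "e / (2 * C + 1)" "1/2"] \<open>e > 0\<close> \<open>C \<ge> 0\<close> by auto
    then have "(2 * C + 1) * (1/2) ^ N < e"
      using \<open>C \<ge> 0\<close> by (simp add: pos_less_divide_eq mult.commute)
    then have "2 * C * (1/2) ^ N < e" by (simp add: distrib_right) (smt (verit) zero_less_power half_gt_zero)
    then have "dist (f m) (f n) < e" if "N \<le> m" "N \<le> n" for m n
      using le[of N m n] le[of N n m] that by (cases "m \<le> n") (auto simp: dist_commute)
    then show "\<exists>N. \<forall>m\<ge>N. \<forall>n\<ge>N. dist (f m) (f n) < e" by blast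
  qed
  then show ?thesis using Cauchy_convergent convergent_def by blast
qed

lemma near_minimizer_exists:
  fixes f :: "'a \<Rightarrow> real"
  assumes "E \<noteq> {}" "\<And>x. x \<in> E \<Longrightarrow> m \<le> f x" "\<epsilon> > 0"
  shows "\<exists>y\<in>E. \<forall>x\<in>E. f y \<le> f x + \<epsilon>"
proof -
  have bdd: "bdd_below (f ` E)" using assms(2) by (rule bdd_belowI2)
  have "(INF x\<in>E. f x) < (INF x\<in>E. f x) + \<epsilon>" using assms(3) by simp
  then obtain y where "y \<in> E" "f y < (INF x\<in>E. f x) + \<epsilon>"
    using cINF_less_iff[OF assms(1) bdd] by blast
  then show ?thesis
    using cINF_lower[OF bdd] by (intro bexI[of _ y]) (smt (verit), auto)
qed

text \<open>
  The smooth variational principle of Borwein and Preiss in a Hilbert space. A bounded closed set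
  need not be compact, so minima may fail to exist; a quadratic perturbation with arbitrarily small
  coefficients restores them. The minimiser is the limit of near minimisers \<open>y\<^sub>n\<close>, each of which is
  pinned by adding a small multiple of \<open>|x - y\<^sub>n|\<^sup>2\<close> to the function.
\<close>

lemma quadratic_variational_principle:
  fixes f :: "'a::{real_inner, complete_space} \<Rightarrow> real"
  assumes E: "closed E" "bounded E" "E \<noteq> {}"
    and f: "continuous_on E f" "\<And>x. x \<in> E \<Longrightarrow> m \<le> f x"
    and "\<epsilon> > 0"
  shows "\<exists>y\<in>E. \<exists>\<xi>. norm \<xi> \<le> \<epsilon> \<and> (\<forall>x\<in>E. f y \<le> f x + \<xi> \<bullet> (x - y) + \<epsilon> * (norm (x - y))\<^sup>2)"
proof -
  obtain M where M: "norm x \<le> M" if "x \<in> E" for x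
    using E(2) unfolding bounded_iff by blast
  have "M \<ge> 0" using M E(3) by (meson all_not_in_conv norm_ge_zero order_trans)
  define \<eta> where "\<eta> = \<epsilon> / (4 * M + 1)"
  have \<eta>: "\<eta> > 0" "\<eta> \<le> \<epsilon>" "\<eta> * (4 * M) \<le> \<epsilon>"
    using \<open>M \<ge> 0\<close> \<open>\<epsilon> > 0\<close> by (auto simp: \<eta>_def field_simps)
  define \<delta> where "\<delta> n = \<eta> * (1/2) ^ Suc n" for n :: nat
  define a where "a n = \<eta> * (1 - (1/2) ^ n)" for n :: nat
  define \<epsilon>n where "\<epsilon>n n = \<delta> n * (1/4) ^ n / 2" for n :: nat
  have \<delta>: "\<delta> n > 0" for n using \<eta> by (simp add: \<delta>_def)
  have a_Suc: "a (Suc n) = a n + \<delta> n" for n by (simp add: a_def \<delta>_def algebra_simps)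
  have a0: "0 \<le> a n" for n
    using \<eta> by (auto simp: a_def power_le_one intro!: mult_nonneg_nonneg)
  have \<epsilon>n: "\<epsilon>n n > 0" "\<epsilon>n (Suc n) \<le> \<epsilon>n n" for n
    using \<delta>[of n] \<eta> by (simp_all add: \<epsilon>n_def \<delta>_def)
  \<comment> \<open>Adding \<delta> n |x - y_n|^2 in each step changes only the coefficients of |x|^2 and of the linear term,
    up to a constant; this is F with coefficients a n and b, so the limit problem is again quadratic.\<close>
  define F where "F n b x = f x + a n * (norm x)\<^sup>2 - 2 * (b \<bullet> x)" for n :: nat and b x :: 'a
  \<comment> \<open>The third part of P bounds the gradient of the perturbation at any point of E; in the limit it
    controls \<xi>.\<close>
  define P where "P n yb \<longleftrightarrow> fst yb \<in> E \<and> (\<forall>x\<in>E. F n (snd yb) (fst yb) \<le> F n (snd yb) x + \<epsilon>n n)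
      \<and> (\<forall>x\<in>E. norm (a n *\<^sub>R x - snd yb) \<le> a n * (2 * M))" for n and yb :: "'a \<times> 'a"
  have ex: "\<exists>y\<in>E. \<forall>x\<in>E. F n b y \<le> F n b x + \<epsilon>n n" for n b
  proof (rule near_minimizer_exists[OF E(3) _ \<epsilon>n(1)])
    fix x assume "x \<in> E"
    have "b \<bullet> x \<le> norm b * norm x" by (rule norm_cauchy_schwarz)
    also have "\<dots> \<le> norm b * M" using M[OF \<open>x \<in> E\<close>] by (simp add: mult_left_mono)
    finally show "m - 2 * (norm b * M) \<le> F n b x"
      using f(2)[OF \<open>x \<in> E\<close>] a0[of n] unfolding F_def
      by (smt (verit) mult_nonneg_nonneg zero_le_power2)
  qed
  have "\<exists>yb. \<forall>n. P n (yb n) \<and> snd (yb (Suc n)) = snd (yb n) + \<delta> n *\<^sub>R fst (yb n)"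
  proof (rule dependent_nat_choice)
    obtain y where "y \<in> E" "\<forall>x\<in>E. F 0 0 y \<le> F 0 0 x + \<epsilon>n 0" using ex by blast
    then show "\<exists>yb. P 0 yb" by (intro exI[of _ "(y, 0)"]) (simp add: P_def a_def)
  next
    fix yb n assume P: "P n yb"
    define b where "b = snd yb + \<delta> n *\<^sub>R fst yb"
    obtain y where y: "y \<in> E" "\<forall>x\<in>E. F (Suc n) b y \<le> F (Suc n) b x + \<epsilon>n (Suc n)" using ex by blast
    have "norm (a (Suc n) *\<^sub>R x - b) \<le> a (Suc n) * (2 * M)" if "x \<in> E" for x
    proof -
      have "a (Suc n) *\<^sub>R x - b = (a n *\<^sub>R x - snd yb) + \<delta> n *\<^sub>R (x - fst yb)"
        by (simp add: a_Suc b_def algebra_simps)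
      also have "norm \<dots> \<le> norm (a n *\<^sub>R x - snd yb) + \<delta> n * norm (x - fst yb)"
        using norm_triangle_ineq \<delta>[of n] by (smt (verit) norm_scaleR)
      also have "norm (x - fst yb) \<le> 2 * M"
        using M[OF that] M[of "fst yb"] P norm_triangle_ineq4[of x "fst yb"] by (simp add: P_def)
      also have "norm (a n *\<^sub>R x - snd yb) \<le> a n * (2 * M)" using P that by (simp add: P_def)
      finally show ?thesis using \<delta>[of n] by (simp add: a_Suc distrib_right)
    qed
    with y show "\<exists>yb'. P (Suc n) yb' \<and> snd yb' = snd yb + \<delta> n *\<^sub>R fst yb"
      by (intro exI[of _ "(y, b)"]) (simp add: P_def b_def)
  qed
  then obtain yb where yb: "P n (yb n)" "snd (yb (Suc n)) = snd (yb n) + \<delta> n *\<^sub>R fst (yb n)" for n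
    by blast
  define y where "y n = fst (yb n)" for n
  define b where "b n = snd (yb n)" for n
  have yE: "y n \<in> E" and ymin: "\<And>x. x \<in> E \<Longrightarrow> F n (b n) (y n) \<le> F n (b n) x + \<epsilon>n n"
    and ab: "\<And>x. x \<in> E \<Longrightarrow> norm (a n *\<^sub>R x - b n) \<le> a n * (2 * M)"
    and b_Suc: "b (Suc n) = b n + \<delta> n *\<^sub>R y n" for n
    using yb[of n] by (simp_all add: P_def y_def b_def)
  have F_Suc: "F (Suc n) (b (Suc n)) x - F (Suc n) (b (Suc n)) (y n)
      = F n (b n) x - F n (b n) (y n) + \<delta> n * (norm (x - y n))\<^sup>2" for n x
    unfolding F_def a_Suc b_Suc power2_norm_eq_inner
    by (simp add: inner_diff_left inner_diff_right inner_add_left inner_commute algebra_simps)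
  have "dist (y (Suc n)) (y n) \<le> 1 * (1/2) ^ n" for n
  proof -
    have "\<delta> n * (norm (y (Suc n) - y n))\<^sup>2 \<le> \<epsilon>n n + \<epsilon>n (Suc n)"
      using F_Suc[of n "y (Suc n)"] ymin[OF yE[of n], of "Suc n"] ymin[OF yE[of "Suc n"], of n] by simp
    also have "\<dots> \<le> 2 * \<epsilon>n n" using \<epsilon>n(2)[of n] by simp
    also have "\<dots> = \<delta> n * (1/4) ^ n" by (simp add: \<epsilon>n_def)
    finally have "(norm (y (Suc n) - y n))\<^sup>2 \<le> (1/4) ^ n"
      using \<delta>[of n] by (simp only: mult_le_cancel_left_pos)
    also have "(1/4) ^ n = (((1/2) ^ n)\<^sup>2 :: real)"
      by (simp add: power2_eq_square flip: power_mult_distrib)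
    finally have "(norm (y (Suc n) - y n))\<^sup>2 \<le> ((1/2) ^ n)\<^sup>2" .
    then have "norm (y (Suc n) - y n) \<le> (1/2) ^ n" by (rule power2_le_imp_le) simp
    then show ?thesis by (simp add: dist_norm)
  qed
  then obtain l where l: "y \<longlonglongrightarrow> l" using convergent_of_geometric_increments by blast
  then have "l \<in> E" using E(1) yE closed_sequentially by blast
  have "dist (b (Suc n)) (b n) \<le> (\<eta> * M / 2) * (1/2) ^ n" for n
  proof -
    have "dist (b (Suc n)) (b n) = \<delta> n * norm (y n)" using \<delta>[of n] by (simp add: b_Suc dist_norm)
    also have "\<dots> \<le> \<delta> n * M" using \<delta>[of n] M[OF yE] by simp
    finally show ?thesis by (simp add: \<delta>_def mult_ac)
  qed
  then obtain c where c: "b \<longlonglongrightarrow> c" using convergent_of_geometric_increments by blast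
  have half: "(\<lambda>n. (1/2) ^ n :: real) \<longlonglongrightarrow> 0" and quarter: "(\<lambda>n. (1/4) ^ n :: real) \<longlonglongrightarrow> 0"
    by (rule LIMSEQ_power_zero; simp)+
  have "a \<longlonglongrightarrow> \<eta> * (1 - 0)"
    unfolding a_def by (intro tendsto_intros half)
  then have a: "a \<longlonglongrightarrow> \<eta>" by simp
  have "\<epsilon>n \<longlonglongrightarrow> \<eta> * (1/2 * 0) * 0 / 2"
    unfolding \<epsilon>n_def \<delta>_def power_Suc by (intro tendsto_intros half quarter) simp
  then have \<epsilon>n0: "\<epsilon>n \<longlonglongrightarrow> 0" by simp
  have fl: "(\<lambda>n. f (y n)) \<longlonglongrightarrow> f l"
    using continuous_on_tendsto_compose[OF f(1) l \<open>l \<in> E\<close>] yE by simp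
  define \<xi> where "\<xi> = 2 *\<^sub>R (\<eta> *\<^sub>R l - c)"
  have "norm (\<eta> *\<^sub>R l - c) \<le> \<eta> * (2 * M)"
  proof (rule LIMSEQ_le)
    show "(\<lambda>n. norm (a n *\<^sub>R l - b n)) \<longlonglongrightarrow> norm (\<eta> *\<^sub>R l - c)" by (intro tendsto_intros a c)
    show "(\<lambda>n. a n * (2 * M)) \<longlonglongrightarrow> \<eta> * (2 * M)" by (intro tendsto_intros a)
  qed (use ab[OF \<open>l \<in> E\<close>] in blast)
  then have "norm \<xi> \<le> \<epsilon>" using \<eta>(3) by (simp add: \<xi>_def)
  moreover have "f l \<le> f x + \<xi> \<bullet> (x - l) + \<epsilon> * (norm (x - l))\<^sup>2" if "x \<in> E" for x
  proof -
    have "f l + \<eta> * (norm l)\<^sup>2 - 2 * (c \<bullet> l) \<le> f x + \<eta> * (norm x)\<^sup>2 - 2 * (c \<bullet> x) + 0"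
    proof (rule LIMSEQ_le)
      show "(\<lambda>n. F n (b n) (y n)) \<longlonglongrightarrow> f l + \<eta> * (norm l)\<^sup>2 - 2 * (c \<bullet> l)"
        unfolding F_def by (intro tendsto_intros a c l fl)
      show "(\<lambda>n. F n (b n) x + \<epsilon>n n) \<longlonglongrightarrow> f x + \<eta> * (norm x)\<^sup>2 - 2 * (c \<bullet> x) + 0"
        unfolding F_def by (intro tendsto_intros a c \<epsilon>n0)
    qed (use ymin[OF that] in blast)
    then have "f l \<le> f x + \<xi> \<bullet> (x - l) + \<eta> * (norm (x - l))\<^sup>2"
      unfolding \<xi>_def power2_norm_eq_inner
      by (simp add: inner_diff_left inner_diff_right inner_commute algebra_simps)
    also have "\<dots> \<le> f x + \<xi> \<bullet> (x - l) + \<epsilon> * (norm (x - l))\<^sup>2"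
      using \<eta>(2) by (simp add: mult_right_mono)
    finally show ?thesis .
  qed
  ultimately show ?thesis using \<open>l \<in> E\<close> by blast
qed

section \<open>A mean value inequality for proximal subgradients\<close>

text \<open>
  The norm lies below a quadratic function that touches it at \<open>y\<close>. With such bounds for all
  terms of a penalty, a minimiser yields a proximal subgradient without any differentiation.
\<close>

lemma norm_quadratic_upper_bound:
  fixes y h :: "'a::real_inner"
  assumes "y \<noteq> 0"
  shows "norm (y + h) \<le> norm y + (y \<bullet> h) / norm y + (norm h)\<^sup>2 / (2 * norm y)"
proof -
  have "norm (y + h) * (2 * norm y) \<le> (norm (y + h))\<^sup>2 + (norm y)\<^sup>2"
    using zero_le_power2[of "norm (y + h) - norm y"] by (simp add: power2_diff)
  also have "\<dots> = 2 * (norm y)\<^sup>2 + 2 * (y \<bullet> h) + (norm h)\<^sup>2"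
    unfolding power2_norm_eq_inner by (simp add: inner_add_left inner_add_right inner_commute)
  also have "\<dots> = (norm y + (y \<bullet> h) / norm y + (norm h)\<^sup>2 / (2 * norm y)) * (2 * norm y)"
    using assms by (simp add: power2_eq_square field_simps)
  finally show ?thesis using assms by simp
qed

lemma hinge_square_upper_bound:
  fixes t t' :: real
  shows "(max 0 t')\<^sup>2 \<le> (max 0 t)\<^sup>2 + 2 * max 0 t * (t' - t) + (t' - t)\<^sup>2"
proof -
  have "(max 0 t + (t' - t))\<^sup>2 \<ge> (max 0 t')\<^sup>2"
  proof (cases "t' \<ge> 0")
    case True
    then show ?thesis by (intro power_mono) auto
  qed simp
  then show ?thesis by (simp add: power2_sum)
qed

text \<open>
  A mean value inequality on a set \<open>D\<close> that is only known to be closed. If all proximal subgradients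
  of \<open>\<phi>\<close> on \<open>D\<close> are bounded by \<open>L\<close>, then \<open>p\<close> must belong to \<open>D\<close> and \<open>\<phi>\<close> grows at rate at most \<open>L\<close>
  from \<open>a\<close> to \<open>p\<close>. Otherwise, for some \<open>L' > L\<close>, a perturbed minimiser of
  \<open>\<phi> + L'|\<cdot> - p|\<close> over \<open>D\<close> avoids \<open>p\<close>, and the slope \<open>L'\<close> of the norm there is balanced by a
  subgradient of \<open>\<phi>\<close> of norm greater than \<open>L\<close>. The quadratic penalty only keeps the minimiser away
  from the sphere of radius \<open>\<rho>\<close>.
\<close>

lemma mean_value_proximal:
  fixes \<phi> :: "'a::{real_inner, complete_space} \<Rightarrow> real"
  assumes D: "closed D" "a \<in> D" "norm (a - p) < \<rho>"
    and lip: "K-lipschitz_on D \<phi>" and "L \<ge> 0"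
    and sub: "\<And>y \<zeta> C r. y \<in> D \<Longrightarrow> norm (y - p) < \<rho> \<Longrightarrow> r > 0 \<Longrightarrow>
        (\<And>x. x \<in> D \<Longrightarrow> norm (x - y) < r \<Longrightarrow> \<phi> y + \<zeta> \<bullet> (x - y) - C * (norm (x - y))\<^sup>2 \<le> \<phi> x) \<Longrightarrow>
        norm \<zeta> \<le> L"
  shows "p \<in> D \<and> \<phi> p \<le> \<phi> a + L * norm (a - p)"
proof (rule ccontr)
  assume neg: "\<not> ?thesis"
  define d where "d = norm (a - p)"
  have d: "0 \<le> d" "d < \<rho>" using D by (auto simp: d_def)
  have "\<exists>L' \<tau>. L' > L \<and> \<tau> > 0 \<and> \<tau> \<le> 1 \<and> (p \<in> D \<longrightarrow> \<phi> a + L' * d + \<tau> \<le> \<phi> p)"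
  proof (cases "p \<in> D")
    case True
    define \<gamma> where "\<gamma> = \<phi> p - \<phi> a - L * d"
    have "\<gamma> > 0" using neg True by (simp add: \<gamma>_def d_def)
    have \<gamma>: "\<phi> p = \<phi> a + L * d + \<gamma>" by (simp add: \<gamma>_def)
    have "\<gamma> / (2 * (d + 1)) * d \<le> \<gamma> / 2" using \<open>\<gamma> > 0\<close> d by (simp add: field_simps)
    then have "(L + \<gamma> / (2 * (d + 1))) * d \<le> L * d + \<gamma> / 2" by (simp only: distrib_right)
    then have "\<phi> a + (L + \<gamma> / (2 * (d + 1))) * d + min 1 (\<gamma> / 2) \<le> \<phi> p"
      using min.cobounded2[of 1 "\<gamma> / 2"] \<gamma> by linarith
    moreover have "L < L + \<gamma> / (2 * (d + 1))" "0 < min 1 (\<gamma> / 2)" "min 1 (\<gamma> / 2) \<le> 1"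
      using \<open>\<gamma> > 0\<close> d by simp_all
    ultimately show ?thesis by blast
  next
    case False
    then show ?thesis by (intro exI[of _ "L + 1"] exI[of _ 1]) simp
  qed
  then obtain L' \<tau> where "L' > L" and \<tau>: "\<tau> > 0" "\<tau> \<le> 1" and p: "p \<in> D \<Longrightarrow> \<phi> a + L' * d + \<tau> \<le> \<phi> p"
    by blast
  have "L' > 0" using \<open>L' > L\<close> \<open>L \<ge> 0\<close> by simp
  have "K \<ge> 0" using lip lipschitz_on_nonneg by blast
  \<comment> \<open>N makes the penalised function exceed its value at a on the sphere of radius \<rho>, whatever the
    Lipschitz function does there; the penalty vanishes at a and at p.\<close>
  define N where "N = (K * (\<rho> + d) + 1) / (\<rho> - d)\<^sup>2"
  have "N > 0" using \<open>K \<ge> 0\<close> d by (auto simp: N_def intro!: divide_pos_pos add_nonneg_pos)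
  define E where "E = D \<inter> cball p \<rho>"
  define F where "F x = \<phi> x + (L' * norm (x - p) + N * (max 0 (norm (x - p) - d))\<^sup>2)" for x
  have E: "closed E" "bounded E" "a \<in> E"
    using D by (auto simp: E_def dist_norm norm_minus_commute)
  have Ed: "x \<in> D" "norm (x - p) \<le> \<rho>" "norm (x - a) \<le> \<rho> + d" if "x \<in> E" for x
    using that norm_triangle_ineq4[of "x - p" "a - p"]
    by (auto simp: E_def dist_norm norm_minus_commute d_def)
  have low: "\<phi> a - K * (\<rho> + d) \<le> \<phi> x" if "x \<in> E" for x
  proof -
    have "\<bar>\<phi> x - \<phi> a\<bar> \<le> K * norm (x - a)"
      using lipschitz_onD[OF lip Ed(1)[OF that] D(2)] by (simp add: dist_norm)
    also have "\<dots> \<le> K * (\<rho> + d)" using Ed(3)[OF that] \<open>K \<ge> 0\<close> by (rule mult_left_mono)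
    finally show ?thesis by linarith
  qed
  define Q where "Q = 2 * \<rho> + 4 * \<rho>\<^sup>2"
  define \<epsilon> where "\<epsilon> = min ((L' - L) / 2) (\<tau> / (2 * (Q)))"
  have "\<rho> > 0" using d by simp
  then have q: "Q > 0" by (simp add: Q_def add_pos_pos)
  have "\<epsilon> > 0" using \<open>L' > L\<close> \<tau> q by (simp add: \<epsilon>_def)
  have "\<epsilon> * (Q) \<le> \<tau> / (2 * (Q)) * (Q)"
    using q by (intro mult_right_mono) (auto simp: \<epsilon>_def)
  also have "\<dots> < \<tau>" using q \<tau> by simp
  finally have \<epsilon>\<tau>: "\<epsilon> * (Q) < \<tau>" .
  have "\<epsilon> < L' - L" using \<open>L' > L\<close>
    unfolding \<epsilon>_def by (intro min.strict_coboundedI1) (simp add: field_simps)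
  have "\<exists>y\<in>E. \<exists>\<xi>. norm \<xi> \<le> \<epsilon> \<and> (\<forall>x\<in>E. F y \<le> F x + \<xi> \<bullet> (x - y) + \<epsilon> * (norm (x - y))\<^sup>2)"
  proof (rule quadratic_variational_principle)
    have "continuous_on E \<phi>"
      using lipschitz_on_continuous_on[OF lip] by (rule continuous_on_subset) (auto simp: E_def)
    then show "continuous_on E F" unfolding F_def by (intro continuous_intros)
    show "\<phi> a - K * (\<rho> + d) \<le> F x" if "x \<in> E" for x
      using low[OF that] \<open>L' > 0\<close> \<open>N > 0\<close> unfolding F_def by (smt (verit) mult_nonneg_nonneg norm_ge_zero zero_le_power2)
  qed (use E \<open>\<epsilon> > 0\<close> in auto)
  then obtain y \<xi> where y: "y \<in> E" "norm \<xi> \<le> \<epsilon>"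
    and min: "\<And>x. x \<in> E \<Longrightarrow> F y \<le> F x + \<xi> \<bullet> (x - y) + \<epsilon> * (norm (x - y))\<^sup>2"
    by blast
  have "F y < F a + \<tau>"
  proof -
    have n: "norm (a - y) \<le> 2 * \<rho>" using Ed(3)[OF y(1)] d by (simp add: norm_minus_commute)
    have "\<xi> \<bullet> (a - y) \<le> norm \<xi> * norm (a - y)" by (rule norm_cauchy_schwarz)
    also have "\<dots> \<le> \<epsilon> * (2 * \<rho>)" using y n \<open>\<epsilon> > 0\<close> by (intro mult_mono) auto
    finally have "\<xi> \<bullet> (a - y) \<le> \<epsilon> * (2 * \<rho>)" .
    moreover have "(norm (a - y))\<^sup>2 \<le> (2 * \<rho>)\<^sup>2" using n by (intro power_mono) auto
    then have "\<epsilon> * (norm (a - y))\<^sup>2 \<le> \<epsilon> * (4 * \<rho>\<^sup>2)" using \<open>\<epsilon> > 0\<close> by (simp add: power_mult_distrib)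
    ultimately show ?thesis using min[OF E(3)] \<epsilon>\<tau> by (simp add: Q_def distrib_left)
  qed
  also have "F a = \<phi> a + L' * d" by (simp add: F_def d_def)
  finally have Fy: "F y < \<phi> a + L' * d + \<tau>" .
  have "y \<noteq> p"
  proof
    assume "y = p"
    then have "\<phi> p < \<phi> a + L' * d + \<tau>" using Fy d by (simp add: F_def)
    with p Ed(1)[OF y(1)] \<open>y = p\<close> show False by simp
  qed
  define t where "t = norm (y - p)"
  have "t > 0" using \<open>y \<noteq> p\<close> by (simp add: t_def)
  have "t \<noteq> \<rho>"
  proof
    assume "t = \<rho>"
    then have "F y = \<phi> y + (L' * \<rho> + (K * (\<rho> + d) + 1))"
      using d by (simp add: F_def N_def flip: t_def)
    moreover have "L' * d \<le> L' * \<rho>" using d \<open>L' > 0\<close> by simp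
    ultimately show False using Fy low[OF y(1)] \<tau> by linarith
  qed
  then have "t < \<rho>" using Ed(2)[OF y(1)] by (simp add: t_def)
  \<comment> \<open>s is the radial derivative at y of the penalised distance to p.\<close>
  define s where "s = L' + 2 * N * max 0 (t - d)"
  have "s \<ge> L'" using \<open>N > 0\<close> by (simp add: s_def)
  define \<zeta> where "\<zeta> = - ((s / t) *\<^sub>R (y - p)) - \<xi>"
  have "norm \<zeta> \<le> L"
  proof (rule sub)
    show "y \<in> D" "norm (y - p) < \<rho>" "\<rho> - t > 0"
      using Ed(1)[OF y(1)] \<open>t < \<rho>\<close> by (auto simp: t_def)
    fix x assume x: "x \<in> D" "norm (x - y) < \<rho> - t"
    have "norm (x - p) \<le> norm (x - y) + t"
      using norm_triangle_ineq[of "x - y" "y - p"] by (simp add: t_def)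
    then have "x \<in> E" using x by (simp add: E_def dist_norm norm_minus_commute)
    define t' where "t' = norm (x - p)"
    have "\<bar>t' - t\<bar> \<le> norm (x - y)"
      using norm_triangle_ineq3[of "x - p" "y - p"] by (simp add: t_def t'_def)
    then have sq: "(t' - t)\<^sup>2 \<le> (norm (x - y))\<^sup>2"
      by (simp add: abs_le_square_iff[symmetric])
    have "(max 0 (t' - d))\<^sup>2 \<le> (max 0 (t - d))\<^sup>2 + 2 * max 0 (t - d) * (t' - t) + (t' - t)\<^sup>2"
      using hinge_square_upper_bound[of "t' - d" "t - d"] by simp
    then have "N * (max 0 (t' - d))\<^sup>2
        \<le> N * ((max 0 (t - d))\<^sup>2 + 2 * max 0 (t - d) * (t' - t) + (norm (x - y))\<^sup>2)"
      using \<open>N > 0\<close> sq by (intro mult_left_mono) auto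
    then have "L' * t' + N * (max 0 (t' - d))\<^sup>2
        \<le> L' * t + N * (max 0 (t - d))\<^sup>2 + s * (t' - t) + N * (norm (x - y))\<^sup>2"
      by (simp add: s_def algebra_simps)
    moreover have "s * (t' - t) \<le> s * (((y - p) \<bullet> (x - y)) / t + (norm (x - y))\<^sup>2 / (2 * t))"
      using norm_quadratic_upper_bound[of "y - p" "x - y"] \<open>y \<noteq> p\<close> \<open>s \<ge> L'\<close> \<open>L' > 0\<close>
      by (intro mult_left_mono) (auto simp: t_def t'_def)
    ultimately have "\<phi> y \<le> \<phi> x + s * (((y - p) \<bullet> (x - y)) / t + (norm (x - y))\<^sup>2 / (2 * t))
        + N * (norm (x - y))\<^sup>2 + \<xi> \<bullet> (x - y) + \<epsilon> * (norm (x - y))\<^sup>2"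
      using min[OF \<open>x \<in> E\<close>] by (simp add: F_def flip: t_def t'_def)
    moreover have "\<zeta> \<bullet> (x - y) = - (s * (((y - p) \<bullet> (x - y)) / t)) - \<xi> \<bullet> (x - y)"
      unfolding \<zeta>_def
      by (simp only: inner_diff_left[of "- ((s / t) *\<^sub>R (y - p))" \<xi>] inner_minus_left inner_scaleR_left) simp
    ultimately show "\<phi> y + \<zeta> \<bullet> (x - y) - (s / (2 * t) + N + \<epsilon>) * (norm (x - y))\<^sup>2 \<le> \<phi> x"
      by (simp add: distrib_left distrib_right)
  qed
  moreover have "norm \<zeta> \<ge> s - \<epsilon>"
  proof -
    have "s = norm ((s / t) *\<^sub>R (y - p))" using \<open>t > 0\<close> \<open>s \<ge> L'\<close> \<open>L' > 0\<close> by (simp add: t_def)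
    also have "\<dots> = norm (\<zeta> + \<xi>)" by (simp add: \<zeta>_def)
    finally show ?thesis using norm_triangle_ineq[of \<zeta> \<xi>] y(2) by linarith
  qed
  ultimately show False using \<open>s \<ge> L'\<close> \<open>\<epsilon> < L' - L\<close> by linarith
qed

section \<open>Monotonicity and surjectivity from the coderivative\<close>

text \<open>
  Let \<open>\<theta>\<close> be the local inverse of \<open>T + sI\<close>, a Lipschitz map on a closed set \<open>D\<close> of values, and
  \<open>K = \<kappa> + s\<close>. The bound on the coderivative says that all proximal subgradients of
  \<open>y \<mapsto> d \<bullet> (2K\<theta>(y) - y)\<close> are bounded by \<open>|d|\<close>. The mean value inequality with \<open>d = 0\<close> shows that
  \<open>D\<close> is a neighborhood of the base value; with general \<open>d\<close> it shows that \<open>2K\<theta> - I\<close> is nonexpansive,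
  that is, \<open>T + sI\<close> is strongly monotone with modulus \<open>K\<close> and \<open>T\<close> with modulus \<open>\<kappa>\<close>.
\<close>

lemma shifted_onto_and_monotone_of_coderivative_bound:
  fixes T :: "'a::{real_inner, complete_space} \<Rightarrow> 'a set"
  assumes "e > 0" and base: "(xb, vb) \<in> gph T"
    and closed: "closed (gph T \<inter> cball xb e \<times> cball vb e)"
    and "\<kappa> > 0" "s \<ge> 0" "\<mu> + s > 0"
    and mono: "strongly_monotone_set \<mu> (gph T \<inter> cball xb e \<times> cball vb e)"
    and cod: "\<And>u v w z. (u, v) \<in> gph T \<inter> cball xb e \<times> cball vb e \<Longrightarrow>
        z \<in> regular_coderivative T u v w \<Longrightarrow> \<kappa> * (norm w)\<^sup>2 \<le> z \<bullet> w"
  shows "\<exists>R>0. (\<forall>y\<in>ball (vb + s *\<^sub>R xb) R. \<exists>u. (u, y - s *\<^sub>R u) \<in> gph T \<inter> cball xb e \<times> cball vb e) \<and>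
      strongly_monotone_set \<kappa>
        {(u, v) \<in> gph T \<inter> cball xb e \<times> cball vb e. v + s *\<^sub>R u \<in> ball (vb + s *\<^sub>R xb) R}"
proof -
  define G where "G = gph T \<inter> cball xb e \<times> cball vb e"
  define yb where "yb = vb + s *\<^sub>R xb"
  define \<sigma> where "\<sigma> = \<mu> + s"
  define K where "K = \<kappa> + s"
  have "\<sigma> > 0" "K > 0" using assms by (simp_all add: \<sigma>_def K_def)
  have baseG: "(xb, vb) \<in> G" using base \<open>e > 0\<close> by (simp add: G_def)
  have lipG: "norm (u1 - u2) \<le> norm ((v1 + s *\<^sub>R u1) - (v2 + s *\<^sub>R u2)) / \<sigma>"
    if "(u1, v1) \<in> G" "(u2, v2) \<in> G" for u1 v1 u2 v2
  proof (rule strongly_monotone_inverse_lipschitz[OF \<open>\<sigma> > 0\<close>])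
    have "(v1 + s *\<^sub>R u1 - (v2 + s *\<^sub>R u2)) \<bullet> (u1 - u2) = (v1 - v2) \<bullet> (u1 - u2) + s * (norm (u1 - u2))\<^sup>2"
      unfolding power2_norm_eq_inner by (simp add: inner_diff_left inner_add_left algebra_simps)
    then show "\<sigma> * (norm (u1 - u2))\<^sup>2 \<le> (v1 + s *\<^sub>R u1 - (v2 + s *\<^sub>R u2)) \<bullet> (u1 - u2)"
      using strongly_monotone_setD[OF mono, of u1 v1 u2 v2] that
      by (simp add: \<sigma>_def G_def distrib_right)
  qed
  \<comment> \<open>c converts a radius in y = v + s u into radii in u and v; points of G over the ball of radius R
    then stay off the boundary of the box, where G and gph T could differ.\<close>
  define c where "c = 1 / \<sigma> + 1 + s / \<sigma>"
  have c: "c > 0" "1 / \<sigma> \<le> c" "1 + s / \<sigma> \<le> c"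
    using \<open>\<sigma> > 0\<close> \<open>s \<ge> 0\<close> by (auto simp: c_def add_pos_nonneg)
  define R where "R = e / (2 * c)"
  have "R > 0" "c * R < e" using c \<open>e > 0\<close> by (simp_all add: R_def)
  have near: "norm (u - xb) < e" "norm (v - vb) < e"
    if uv: "(u, v) \<in> G" and R: "norm (v + s *\<^sub>R u - yb) \<le> R" for u v
  proof -
    have "norm (u - xb) \<le> norm (v + s *\<^sub>R u - yb) / \<sigma>"
      using lipG[OF uv baseG] by (simp add: yb_def)
    also have "\<dots> \<le> R / \<sigma>" using R \<open>\<sigma> > 0\<close> by (simp add: divide_right_mono)
    finally have u: "norm (u - xb) \<le> R / \<sigma>" .
    also have "R / \<sigma> \<le> c * R" using mult_right_mono[OF c(2), of R] \<open>R > 0\<close> by simp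
    finally show "norm (u - xb) < e" using \<open>c * R < e\<close> by simp
    have "norm (v - vb) = norm ((v + s *\<^sub>R u - yb) - s *\<^sub>R (u - xb))"
      by (simp add: yb_def algebra_simps)
    also have "\<dots> \<le> R + s * (R / \<sigma>)"
      using norm_triangle_ineq4[of "v + s *\<^sub>R u - yb" "s *\<^sub>R (u - xb)"] R
        mult_left_mono[OF u \<open>s \<ge> 0\<close>] \<open>s \<ge> 0\<close> by simp
    also have "\<dots> \<le> c * R" using mult_right_mono[OF c(3), of R] \<open>R > 0\<close> by (simp add: algebra_simps)
    finally show "norm (v - vb) < e" using \<open>c * R < e\<close> by simp
  qed
  define D where "D = {y \<in> cball yb R. \<exists>u. (u, y - s *\<^sub>R u) \<in> G}"
  have "\<forall>y. \<exists>u. y \<in> D \<longrightarrow> (u, y - s *\<^sub>R u) \<in> G" by (auto simp: D_def)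
  then obtain \<theta> where \<theta>: "(\<theta> y, y - s *\<^sub>R \<theta> y) \<in> G" if "y \<in> D" for y
    by metis
  have \<theta>_lip: "norm (\<theta> y - \<theta> y') \<le> norm (y - y') / \<sigma>" if "y \<in> D" "y' \<in> D" for y y'
    using lipG[OF \<theta>[OF that(1)] \<theta>[OF that(2)]] by simp
  have \<theta>_eq: "\<theta> (v + s *\<^sub>R u) = u" if "(u, v) \<in> G" "v + s *\<^sub>R u \<in> D" for u v
    using lipG[OF \<theta>[OF that(2)] that(1)] by simp
  have inD: "v + s *\<^sub>R u \<in> D" if "(u, v) \<in> G" "norm (v + s *\<^sub>R u - yb) \<le> R" for u v
    using that by (auto simp: D_def dist_norm norm_minus_commute intro!: exI[of _ u])
  have "yb \<in> D" using inD[OF baseG] \<open>R > 0\<close> by (simp add: yb_def)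
  have "closed D"
    unfolding closed_sequential_limits
  proof (intro allI impI, elim conjE)
    fix y l assume yD: "\<forall>n. y n \<in> D" and l: "y \<longlonglongrightarrow> l"
    have "Cauchy (\<lambda>n. \<theta> (y n))"
    proof (rule metric_CauchyI)
      fix \<epsilon> :: real assume "\<epsilon> > 0"
      have "Cauchy y" using l LIMSEQ_imp_Cauchy by blast
      then obtain N where N: "\<And>m n. N \<le> m \<Longrightarrow> N \<le> n \<Longrightarrow> dist (y m) (y n) < \<epsilon> * \<sigma>"
        using metric_CauchyD[of y "\<epsilon> * \<sigma>"] \<open>\<epsilon> > 0\<close> \<open>\<sigma> > 0\<close> by (metis mult_pos_pos)
      have "dist (\<theta> (y m)) (\<theta> (y n)) < \<epsilon>" if "N \<le> m" "N \<le> n" for m n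
      proof -
        have "norm (\<theta> (y m) - \<theta> (y n)) \<le> norm (y m - y n) / \<sigma>" using \<theta>_lip yD by blast
        also have "\<dots> < \<epsilon>" using N[OF that] \<open>\<sigma> > 0\<close> by (simp add: dist_norm pos_divide_less_eq)
        finally show ?thesis by (simp add: dist_norm)
      qed
      then show "\<exists>N. \<forall>m\<ge>N. \<forall>n\<ge>N. dist (\<theta> (y m)) (\<theta> (y n)) < \<epsilon>" by blast
    qed
    then obtain u where u: "(\<lambda>n. \<theta> (y n)) \<longlonglongrightarrow> u" using Cauchy_convergent convergent_def by blast
    have "(\<lambda>n. (\<theta> (y n), y n - s *\<^sub>R \<theta> (y n))) \<longlonglongrightarrow> (u, l - s *\<^sub>R u)"
      by (intro tendsto_intros u l)
    moreover have "(\<theta> (y n), y n - s *\<^sub>R \<theta> (y n)) \<in> G" for n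
      by (rule \<theta>) (simp add: yD)
    ultimately have "(u, l - s *\<^sub>R u) \<in> G"
      using closed_sequentially[OF closed[folded G_def], of "\<lambda>n. (\<theta> (y n), y n - s *\<^sub>R \<theta> (y n))"]
      by (simp only: simp_thms)
    moreover have "l \<in> cball yb R"
      using closed_sequentially[OF closed_cball _ l] yD by (simp add: D_def)
    ultimately show "l \<in> D" by (auto simp: D_def)
  qed
  define \<phi> where "\<phi> d y = d \<bullet> ((2 * K) *\<^sub>R \<theta> y - y)" for d y
  have \<phi>_lip: "(norm d * (2 * K / \<sigma> + 1))-lipschitz_on D (\<phi> d)" for d
  proof (rule lipschitz_onI)
    fix y y' assume D: "y \<in> D" "y' \<in> D"
    have "\<phi> d y - \<phi> d y' = d \<bullet> ((2 * K) *\<^sub>R (\<theta> y - \<theta> y') - (y - y'))"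
      by (simp add: \<phi>_def inner_diff_right algebra_simps)
    also have "\<bar>\<dots>\<bar> \<le> norm d * norm ((2 * K) *\<^sub>R (\<theta> y - \<theta> y') - (y - y'))"
      by (rule Cauchy_Schwarz_ineq2)
    also have "\<dots> \<le> norm d * ((2 * K) * norm (\<theta> y - \<theta> y') + norm (y - y'))"
      using norm_triangle_ineq4[of "(2 * K) *\<^sub>R (\<theta> y - \<theta> y')" "y - y'"] \<open>K > 0\<close>
      by (intro mult_left_mono) auto
    also have "\<dots> \<le> norm d * ((2 * K) * (norm (y - y') / \<sigma>) + norm (y - y'))"
      using \<theta>_lip[OF D] \<open>K > 0\<close> by (intro mult_left_mono add_right_mono) auto
    finally show "dist (\<phi> d y) (\<phi> d y') \<le> norm d * (2 * K / \<sigma> + 1) * dist y y'"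
      by (simp add: dist_norm algebra_simps)
  qed (use \<open>K > 0\<close> \<open>\<sigma> > 0\<close> in simp)
  \<comment> \<open>A proximal subgradient of \<phi> d is a proximal normal to the graph of T in the coordinates
    (u, v + s u); the bound on the coderivative reads there as norm (d + \<zeta>)^2 \<le> 2 d \<bullet> (d + \<zeta>).\<close>
  have sub: "norm \<zeta> \<le> norm d"
    if yD: "y \<in> D" and yR: "norm (y - yb) < R" and "r > 0"
      and ineq: "\<And>x. x \<in> D \<Longrightarrow> norm (x - y) < r \<Longrightarrow>
        \<phi> d y + \<zeta> \<bullet> (x - y) - C * (norm (x - y))\<^sup>2 \<le> \<phi> d x"
    for y \<zeta> d C r
  proof -
    define u where "u = \<theta> y"
    define v where "v = y - s *\<^sub>R u"
    have uv: "(u, v) \<in> G" using \<theta>[OF yD] by (simp add: u_def v_def)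
    have y: "v + s *\<^sub>R u = y" by (simp add: v_def)
    have uve: "norm (u - xb) < e" "norm (v - vb) < e" using near[OF uv] yR by (simp_all add: y)
    define w where "w = - (d + \<zeta>)"
    define z where "z = - ((2 * K) *\<^sub>R d) - s *\<^sub>R w"
    define r' where "r' = min (min (e - norm (u - xb)) (e - norm (v - vb))) (min r (R - norm (y - yb)) / (1 + s))"
    have "r' > 0" using uve yR \<open>r > 0\<close> \<open>s \<ge> 0\<close> by (simp add: r'_def)
    have "(z, - w) \<in> regular_normal_cone (gph T) (u, v)"
    proof (rule proximal_normal_imp_regular[OF \<open>r' > 0\<close>])
      show "0 \<le> \<bar>C\<bar> * (1 + s)\<^sup>2" by simp
      fix q assume q: "q \<in> gph T" "dist q (u, v) < r'"
      obtain u' v' where q_eq: "q = (u', v')" by (cases q)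
      define y' where "y' = v' + s *\<^sub>R u'"
      have nu: "norm (u' - u) \<le> norm (q - (u, v))" and nv: "norm (v' - v) \<le> norm (q - (u, v))"
        using norm_fst_le[of "u' - u" "v' - v"] norm_snd_le[of "v' - v" "u' - u"] by (simp_all add: q_eq)
      have q': "norm (q - (u, v)) < r'" using q(2) by (simp add: dist_norm)
      have yy: "y' - y = (v' - v) + s *\<^sub>R (u' - u)" by (simp add: y'_def v_def algebra_simps)
      have ny: "norm (y' - y) \<le> (1 + s) * norm (q - (u, v))"
        unfolding yy using norm_triangle_ineq[of "v' - v" "s *\<^sub>R (u' - u)"] nv mult_left_mono[OF nu \<open>s \<ge> 0\<close>] \<open>s \<ge> 0\<close>
        by (simp add: distrib_right)
      have "norm (u' - xb) < e" "norm (v' - vb) < e"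
        using norm_triangle_ineq[of "u' - u" "u - xb"] norm_triangle_ineq[of "v' - v" "v - vb"] nu nv q'
        by (simp_all add: r'_def)
      then have uvG: "(u', v') \<in> G"
        using q(1) by (simp add: G_def q_eq dist_norm norm_minus_commute)
      have "(1 + s) * norm (q - (u, v)) < min r (R - norm (y - yb))"
        using q' \<open>s \<ge> 0\<close> by (simp add: r'_def pos_less_divide_eq mult.commute)
      then have yr: "norm (y' - y) < r" "norm (y' - y) < R - norm (y - yb)" using ny by simp_all
      then have "norm (y' - yb) \<le> R" using norm_triangle_ineq[of "y' - y" "y - yb"] by simp
      then have y'D: "y' \<in> D" using inD[OF uvG] by (simp add: y'_def)
      have "\<theta> y' = u'" using \<theta>_eq[OF uvG] y'D by (simp add: y'_def)
      have "(z, - w) \<bullet> (q - (u, v)) = z \<bullet> (u' - u) - w \<bullet> (v' - v)" by (simp add: q_eq)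
      also have "\<dots> = - ((2 * K) * (d \<bullet> (u' - u))) + (d + \<zeta>) \<bullet> (y' - y)"
        unfolding yy by (simp add: z_def w_def inner_diff_left inner_add_left inner_add_right algebra_simps)
      also have "\<dots> = \<phi> d y - \<phi> d y' + \<zeta> \<bullet> (y' - y)"
        unfolding \<phi>_def \<open>\<theta> y' = u'\<close> u_def[symmetric] by (simp add: inner_diff_right inner_add_left algebra_simps)
      also have "\<dots> \<le> C * (norm (y' - y))\<^sup>2" using ineq[OF y'D yr(1)] by simp
      also have "\<dots> \<le> \<bar>C\<bar> * ((1 + s) * norm (q - (u, v)))\<^sup>2"
        using ny by (intro mult_mono power_mono) auto
      finally show "(z, - w) \<bullet> (q - (u, v)) \<le> \<bar>C\<bar> * (1 + s)\<^sup>2 * (norm (q - (u, v)))\<^sup>2"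
        by (simp add: power_mult_distrib mult.assoc)
    qed
    then have "\<kappa> * (norm w)\<^sup>2 \<le> z \<bullet> w"
      using cod uv by (simp add: regular_coderivative_def G_def)
    also have "z \<bullet> w = - (2 * K * (d \<bullet> w)) - s * (norm w)\<^sup>2"
      unfolding power2_norm_eq_inner by (simp add: z_def inner_diff_left)
    finally have "K * (norm w)\<^sup>2 \<le> K * (- (2 * (d \<bullet> w)))" by (simp add: K_def algebra_simps)
    then have "(norm w)\<^sup>2 \<le> - (2 * (d \<bullet> w))" using \<open>K > 0\<close> by (simp only: mult_le_cancel_left_pos)
    then have "(norm \<zeta>)\<^sup>2 \<le> (norm d)\<^sup>2"
      unfolding power2_norm_eq_inner
      by (simp add: w_def inner_diff_left inner_diff_right inner_commute)
    then show ?thesis by (rule power2_le_imp_le) simp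
  qed
  have mv: "p \<in> D \<and> \<phi> d p \<le> \<phi> d a + norm d * norm (a - p)"
    if p: "norm (p - yb) < R / 4" and a: "a \<in> D" "norm (a - yb) < R / 4" for d p a
  proof (rule mean_value_proximal[OF \<open>closed D\<close> a(1), of _ "R / 2", OF _ \<phi>_lip])
    show "norm (a - p) < R / 2"
      using norm_triangle_ineq4[of "a - yb" "p - yb"] p a by simp
    fix y \<zeta> C r
    assume "y \<in> D" "norm (y - p) < R / 2" "r > 0"
      "\<And>x. x \<in> D \<Longrightarrow> norm (x - y) < r \<Longrightarrow> \<phi> d y + \<zeta> \<bullet> (x - y) - C * (norm (x - y))\<^sup>2 \<le> \<phi> d x"
    moreover have "norm (y - yb) < R"
      using norm_triangle_ineq[of "y - p" "p - yb"] p \<open>norm (y - p) < R / 2\<close> \<open>R > 0\<close> by simp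
    ultimately show "norm \<zeta> \<le> norm d" by (intro sub) auto
  qed simp
  \<comment> \<open>With d = 0 the function is constant and the mean value inequality only says that p lies in D.\<close>
  have ball_D: "p \<in> D" if "p \<in> ball yb (R / 4)" for p
    using mv[of p yb 0] that \<open>yb \<in> D\<close> \<open>R > 0\<close> by (simp add: dist_norm norm_minus_commute)
  have contr: "norm ((2 * K) *\<^sub>R (\<theta> p - \<theta> a) - (p - a)) \<le> norm (p - a)"
    if "p \<in> ball yb (R / 4)" "a \<in> ball yb (R / 4)" for p a
  proof -
    \<comment> \<open>The direction that turns the scalar estimate into one for the norm.\<close>
    define d where "d = (2 * K) *\<^sub>R (\<theta> p - \<theta> a) - (p - a)"
    have "\<phi> d p \<le> \<phi> d a + norm d * norm (a - p)"
      using mv[of p a d] that ball_D by (simp add: dist_norm norm_minus_commute)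
    moreover have "\<phi> d p - \<phi> d a = norm d * norm d"
    proof -
      have "\<phi> d p - \<phi> d a = d \<bullet> d" by (simp add: \<phi>_def d_def flip: inner_diff_right) (simp add: algebra_simps)
      then show ?thesis by (simp add: power2_norm_eq_inner[symmetric] power2_eq_square)
    qed
    ultimately have "norm d * norm d \<le> norm d * norm (p - a)" by (simp add: norm_minus_commute)
    then show ?thesis unfolding d_def[symmetric] by (cases "d = 0") auto
  qed
  have "\<kappa> * (norm (u1 - u2))\<^sup>2 \<le> (v1 - v2) \<bullet> (u1 - u2)"
    if G: "(u1, v1) \<in> G" "(u2, v2) \<in> G"
      and y: "v1 + s *\<^sub>R u1 \<in> ball yb (R / 4)" "v2 + s *\<^sub>R u2 \<in> ball yb (R / 4)" for u1 v1 u2 v2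
  proof -
    have "K * (norm (u1 - u2))\<^sup>2 \<le> ((v1 + s *\<^sub>R u1) - (v2 + s *\<^sub>R u2)) \<bullet> (u1 - u2)"
      unfolding strongly_monotone_iff_nonexpansive[OF \<open>K > 0\<close>]
      using contr[OF y] \<theta>_eq[OF G(1) ball_D[OF y(1)]] \<theta>_eq[OF G(2) ball_D[OF y(2)]] by simp
    also have "\<dots> = (v1 - v2) \<bullet> (u1 - u2) + s * (norm (u1 - u2))\<^sup>2"
      unfolding power2_norm_eq_inner by (simp add: inner_diff_left inner_add_left algebra_simps)
    finally show ?thesis by (simp add: K_def distrib_right)
  qed
  then have "strongly_monotone_set \<kappa> {(u, v) \<in> G. v + s *\<^sub>R u \<in> ball yb (R / 4)}"
    unfolding strongly_monotone_set_def by blast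
  moreover have "\<forall>y\<in>ball yb (R / 4). \<exists>u. (u, y - s *\<^sub>R u) \<in> G"
    using ball_D \<theta> by blast
  ultimately show ?thesis
    using \<open>R > 0\<close> unfolding G_def yb_def by (intro exI[of _ "R / 4"]) simp
qed

text \<open>
  The preceding lemma is applied twice. Hypomonotonicity makes a shift of \<open>T\<close> strongly monotone,
  which yields strong monotonicity of \<open>T\<close> itself but surjectivity only for the shift. On a smaller
  box \<open>T\<close> then meets the hypotheses with shift \<open>0\<close>, and this gives its own surjectivity.
\<close>

lemma onto_of_coderivative_bound:
  fixes T :: "'a::{real_inner, complete_space} \<Rightarrow> 'a set"
  assumes base: "(xb, vb) \<in> gph T"
    and lc: "locally_closed_around (gph T) (xb, vb)"
    and "\<kappa> > 0"
    and hypo: "hypomonotone_around T xb vb"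
    and "\<eta> > 0"
    and cod: "\<And>u v w z. (u, v) \<in> gph T \<inter> cball xb \<eta> \<times> cball vb \<eta> \<Longrightarrow>
        z \<in> regular_coderivative T u v w \<Longrightarrow> \<kappa> * (norm w)\<^sup>2 \<le> z \<bullet> w"
  shows "strongly_monotone_onto T xb vb \<kappa>"
proof -
  obtain W where W: "(xb, vb) \<in> interior W" "closed (gph T \<inter> W)"
    using lc unfolding locally_closed_around_def nhd_def by blast
  obtain U V r where UV: "xb \<in> interior U" "vb \<in> interior V" and "r > 0"
    and rmono: "strongly_monotone_set (- r) (gph T \<inter> U \<times> V)"
    using hypo unfolding hypomonotone_around_def nhd_def strongly_monotone_set_def by blast
  have "open (interior W \<inter> interior U \<times> interior V)" "(xb, vb) \<in> interior W \<inter> interior U \<times> interior V"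
    using W UV by (auto intro!: open_Int open_Times)
  then obtain e1 where "e1 > 0" and e1: "ball (xb, vb) e1 \<subseteq> interior W \<inter> interior U \<times> interior V"
    by (meson openE)
  define e where "e = min \<eta> (e1 / 3)"
  have "e > 0" using \<open>\<eta> > 0\<close> \<open>e1 > 0\<close> by (simp add: e_def)
  have box: "cball xb e \<times> cball vb e \<subseteq> W \<inter> U \<times> V"
  proof -
    have "(u, v) \<in> ball (xb, vb) e1" if "u \<in> cball xb e" "v \<in> cball vb e" for u v
    proof -
      have "norm (xb - u, vb - v) \<le> norm (xb - u) + norm (vb - v)" by (rule norm_Pair_le)
      also have "\<dots> < e1" using that \<open>e1 > 0\<close> by (simp add: e_def dist_norm)
      finally show ?thesis by (simp add: dist_norm)
    qed
    then have "cball xb e \<times> cball vb e \<subseteq> interior W \<inter> interior U \<times> interior V"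
      using e1 by blast
    also have "\<dots> \<subseteq> W \<inter> U \<times> V"
      by (intro Int_mono Sigma_mono interior_subset)
    finally show ?thesis .
  qed
  have closed: "closed (gph T \<inter> cball xb e' \<times> cball vb e')" if "e' \<le> e" for e'
  proof -
    have "gph T \<inter> cball xb e' \<times> cball vb e' = (gph T \<inter> W) \<inter> (cball xb e' \<times> cball vb e')"
      using box that by fastforce
    then show ?thesis using W(2) by (simp add: closed_Int closed_Times)
  qed
  have cod': "\<kappa> * (norm w)\<^sup>2 \<le> z \<bullet> w"
    if "e' \<le> e" "(u, v) \<in> gph T \<inter> cball xb e' \<times> cball vb e'" "z \<in> regular_coderivative T u v w" for e' u v w z
    using that cod[of u v z w] by (simp add: e_def)
  \<comment> \<open>First round: the shift s makes T + s I strongly monotone with modulus 1.\<close>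
  define s where "s = r + 1"
  have "strongly_monotone_set (- r) (gph T \<inter> cball xb e \<times> cball vb e)"
    using rmono box unfolding strongly_monotone_set_def by blast
  then obtain R1 where "R1 > 0" and R1: "strongly_monotone_set \<kappa>
      {(u, v) \<in> gph T \<inter> cball xb e \<times> cball vb e. v + s *\<^sub>R u \<in> ball (vb + s *\<^sub>R xb) R1}"
    using shifted_onto_and_monotone_of_coderivative_bound[OF \<open>e > 0\<close> base closed[OF order_refl] \<open>\<kappa> > 0\<close>, of s "- r"]
      cod'[OF order_refl] \<open>r > 0\<close> unfolding s_def by auto
  define e2 where "e2 = min e (R1 / (2 * (1 + s)))"
  have "s > 0" using \<open>r > 0\<close> by (simp add: s_def)
  have e2: "e2 > 0" "e2 \<le> e" "(1 + s) * e2 < R1"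
  proof -
    show "e2 > 0" "e2 \<le> e" using \<open>e > 0\<close> \<open>R1 > 0\<close> \<open>s > 0\<close> by (simp_all add: e2_def)
    have "(1 + s) * e2 \<le> (1 + s) * (R1 / (2 * (1 + s)))"
      using \<open>s > 0\<close> by (intro mult_left_mono) (auto simp: e2_def)
    also have "\<dots> < R1" using \<open>s > 0\<close> \<open>R1 > 0\<close> by (simp add: field_simps add_pos_pos)
    finally show "(1 + s) * e2 < R1" .
  qed
  have "v + s *\<^sub>R u \<in> ball (vb + s *\<^sub>R xb) R1" if "u \<in> cball xb e2" "v \<in> cball vb e2" for u v
  proof -
    have "norm ((vb - v) + s *\<^sub>R (xb - u)) \<le> norm (vb - v) + s * norm (xb - u)"
      using norm_triangle_ineq[of "vb - v" "s *\<^sub>R (xb - u)"] \<open>s > 0\<close> by simp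
    also have "\<dots> \<le> e2 + s * e2"
      using that \<open>s > 0\<close> by (intro add_mono mult_left_mono) (auto simp: dist_norm)
    also have "\<dots> < R1" using e2 by (simp add: distrib_right)
    finally show ?thesis by (simp add: dist_norm algebra_simps)
  qed
  then have mono: "strongly_monotone_set \<kappa> (gph T \<inter> cball xb e2 \<times> cball vb e2)"
    using R1 e2(2) unfolding strongly_monotone_set_def by fastforce
  \<comment> \<open>Second round: T itself is now strongly monotone, so no shift is needed and T covers a ball.\<close>
  obtain R2 where "R2 > 0"
    and R2: "\<And>y. y \<in> ball vb R2 \<Longrightarrow> \<exists>u. (u, y) \<in> gph T \<inter> cball xb e2 \<times> cball vb e2"
    using shifted_onto_and_monotone_of_coderivative_bound[OF e2(1) base closed[OF e2(2)] \<open>\<kappa> > 0\<close>, of 0 \<kappa>]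
      cod'[OF e2(2)] mono \<open>\<kappa> > 0\<close> by auto
  define \<rho> where "\<rho> = min e2 (min R2 (\<kappa> * e2))"
  have "\<rho> > 0" using e2 \<open>R2 > 0\<close> \<open>\<kappa> > 0\<close> by (simp add: \<rho>_def)
  have "\<exists>u\<in>ball xb e2. (u, y) \<in> gph T" if y: "y \<in> ball vb \<rho>" for y
  proof -
    obtain u where u: "(u, y) \<in> gph T \<inter> cball xb e2 \<times> cball vb e2"
      using R2[of y] y by (auto simp: \<rho>_def)
    have "norm (xb - u) \<le> norm (vb - y) / \<kappa>"
      by (rule strongly_monotone_inverse_lipschitz[OF \<open>\<kappa> > 0\<close> strongly_monotone_setD[OF mono]])
        (use base e2 u in auto)
    also have "\<dots> < e2" using y \<open>\<kappa> > 0\<close> by (simp add: \<rho>_def dist_norm pos_divide_less_eq mult.commute)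
    finally show ?thesis using u by (auto simp: dist_norm)
  qed
  moreover have "strongly_monotone_set \<kappa> (gph T \<inter> ball xb e2 \<times> ball vb \<rho>)"
    using mono unfolding strongly_monotone_set_def by (fastforce simp: \<rho>_def)
  ultimately show ?thesis
    unfolding strongly_monotone_onto_def using e2 \<open>\<rho> > 0\<close>
    by (intro exI[of _ "ball xb e2"] exI[of _ "ball vb \<rho>"]) simp
qed

section \<open>The coderivative characterisation\<close>

theorem theorem3p4:
  fixes T :: "'a::{real_inner, complete_space} \<Rightarrow> 'a set"
    and xb vb :: 'a and \<kappa> :: real
  assumes "(xb, vb) \<in> gph T"
    and "locally_closed_around (gph T) (xb, vb)"
    and "\<kappa> > 0"
  defines "cond_i \<equiv> loc_strongly_max_monotone T xb vb \<kappa>"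
    and "cond_ii \<equiv> hypomonotone_around T xb vb \<and>
           (\<exists>\<eta>>0. \<forall>(u, v) \<in> gph T \<inter> (cball xb \<eta> \<times> cball vb \<eta>). \<forall>w.
              \<forall>z \<in> regular_coderivative T u v w. z \<bullet> w \<ge> \<kappa> * (norm w)\<^sup>2)"
  shows "(cond_i \<longleftrightarrow> cond_ii) \<and>
         (cond_ii \<longrightarrow> strongly_metrically_regular T xb vb (inverse \<kappa>))"
proof -
  have i_iff: "cond_i \<longleftrightarrow> strongly_monotone_onto T xb vb \<kappa>"
    unfolding cond_i_def
    using onto_of_loc_strongly_max_monotone[OF _ assms(1)] loc_strongly_max_monotone_of_onto[OF assms(3)]
    by blast
  have "strongly_monotone_onto T xb vb \<kappa>" if "cond_ii"
    using that onto_of_coderivative_bound[OF assms(1-3)] unfolding cond_ii_def by blast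
  moreover have cond_ii if onto: "strongly_monotone_onto T xb vb \<kappa>"
  proof -
    obtain U V where UV: "open U" "open V" "xb \<in> U" "vb \<in> V"
      and mono: "strongly_monotone_set \<kappa> (gph T \<inter> U \<times> V)"
      and surj: "\<forall>y\<in>V. \<exists>u\<in>U. (u, y) \<in> gph T"
      using onto unfolding strongly_monotone_onto_def by blast
    have "\<exists>\<eta>>0. \<forall>(u, v) \<in> gph T \<inter> (cball xb \<eta> \<times> cball vb \<eta>). \<forall>w.
              \<forall>z \<in> regular_coderivative T u v w. z \<bullet> w \<ge> \<kappa> * (norm w)\<^sup>2"
    proof -
      obtain e1 e2 where e: "e1 > 0" "cball xb e1 \<subseteq> U" "e2 > 0" "cball vb e2 \<subseteq> V"
        using UV open_contains_cball by metis
      have "gph T \<inter> (cball xb (min e1 e2) \<times> cball vb (min e1 e2)) \<subseteq> gph T \<inter> U \<times> V"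
        using e by (auto simp: subset_iff)
      moreover have "0 < min e1 e2" using e by simp
      ultimately show ?thesis
        using coderivative_bound_of_onto[OF assms(3) UV(1,2) mono surj] by blast
    qed
    moreover have "hypomonotone_around T xb vb"
      unfolding hypomonotone_around_def
    proof (rule exI[of _ U], rule exI[of _ V], rule exI[of _ 1], intro conjI)
      show "nhd U xb" "nhd V vb" using UV by (simp_all add: nhd_def interior_open)
      have "- 1 * (norm (u1 - u2))\<^sup>2 \<le> (v1 - v2) \<bullet> (u1 - u2)"
        if "(u1, v1) \<in> gph T \<inter> U \<times> V" "(u2, v2) \<in> gph T \<inter> U \<times> V" for u1 v1 u2 v2
        using strongly_monotone_setD[OF mono that] assms(3)
        by (smt (verit) mult_nonneg_nonneg zero_le_power2)
      then show "\<forall>(u1, v1)\<in>gph T \<inter> U \<times> V. \<forall>(u2, v2)\<in>gph T \<inter> U \<times> V.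
          - 1 * (norm (u1 - u2))\<^sup>2 \<le> (v1 - v2) \<bullet> (u1 - u2)" by blast
    qed simp
    ultimately show ?thesis unfolding cond_ii_def by blast
  qed
  ultimately show ?thesis
    using i_iff strongly_metrically_regular_of_onto[OF assms(3)] by blast
qed

end
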